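(* Let $(F,g_F)$ be an $(n-1)$-dimensional compact Riemannian manifold with non-positive definite Ricci tensor, and assume that the Euler--Poincaré characteristic of $F$ is non-zero. Let $\mathbb{R}\times F$ be endowed with the product metric $ds^2+g_F$. The only entire solutions $u\in C^{\infty}(\mathbb{R}\times F)$ of the equation $$\mathrm{div}\left(\frac{Du}{\sqrt{1+|Du|^2}}\right)=0\quad\text{on }\mathbb{R}\times F$$ with bounded length $|Du|$ of the gradient are the functions $u(s,x)=as+b$, $(s,x)\in\mathbb{R}\times F$, with $a,b\in\mathbb{R}$.
   Context: Riemannian manifolds are connected. $Du$, $|Du|$ and $\mathrm{div}$ denote the gradient of $u$, its length, and the divergence in the Riemannian product $\mathbb{R}\times F$. An entire solution is a solution defined on all of $\mathbb{R}\times F$. Non-positive definite Ricci tensor means $\mathrm{Ric}(X,X)\leq 0$ for every tangent vector $X$. *)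

theory Defs
  imports "HOL-Analysis.Analysis" "HOL-Homology.Homology"
begin

section \<open>Smooth maps on open subsets of Euclidean spaces\<close>

text \<open>Meant for open \<open>S\<close>.\<close>

primrec Ck_on ::
  "nat \<Rightarrow> 'e::euclidean_space set \<Rightarrow> ('e \<Rightarrow> 'f::real_normed_vector) \<Rightarrow> bool" where
  "Ck_on 0 S f \<longleftrightarrow> continuous_on S f"
| "Ck_on (Suc k) S f \<longleftrightarrow> (\<forall>x\<in>S. f differentiable (at x)) \<and>
     (\<forall>v. Ck_on k S (\<lambda>x. frechet_derivative f (at x) v))"

definition Cinf_on ::
  "'e::euclidean_space set \<Rightarrow> ('e \<Rightarrow> 'f::real_normed_vector) \<Rightarrow> bool" where
  "Cinf_on S f \<longleftrightarrow> (\<forall>k. Ck_on k S f)"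

section \<open>Riemannian manifolds\<close>

text \<open>
  A Riemannian manifold modelled on \<open>'e\<close> (so of dimension \<open>DIM('e)\<close>) is given by its
  topology, an atlas indexed by \<open>charts\<close>, and the metric tensor in each chart:
  \<open>metric M i y v w\<close> is the inner product, at the point with coordinates \<open>y\<close> in chart \<open>i\<close>,
  of the tangent vectors with components \<open>v\<close> and \<open>w\<close>.
\<close>

record ('i, 'a, 'e) riem_data =
  mtop :: "'a topology"
  charts :: "'i set"
  chart_dom :: "'i \<Rightarrow> 'a set"
  chart :: "'i \<Rightarrow> 'a \<Rightarrow> 'e"
  metric :: "'i \<Rightarrow> 'e \<Rightarrow> 'e \<Rightarrow> 'e \<Rightarrow> real"

definition chart_img :: "('i, 'a, 'e) riem_data \<Rightarrow> 'i \<Rightarrow> 'e set" where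
  "chart_img M i = chart M i ` chart_dom M i"

definition chart_inv :: "('i, 'a, 'e) riem_data \<Rightarrow> 'i \<Rightarrow> 'e \<Rightarrow> 'a" where
  "chart_inv M i = inv_into (chart_dom M i) (chart M i)"

definition transition :: "('i, 'a, 'e) riem_data \<Rightarrow> 'i \<Rightarrow> 'i \<Rightarrow> 'e \<Rightarrow> 'e" where
  "transition M i j = chart M j \<circ> chart_inv M i"

definition second_countable_space :: "'a topology \<Rightarrow> bool" where
  "second_countable_space X \<longleftrightarrow>
     (\<exists>\<B>. countable \<B> \<and> (\<forall>B\<in>\<B>. openin X B) \<and>
          (\<forall>U x. openin X U \<and> x \<in> U \<longrightarrow> (\<exists>B\<in>\<B>. x \<in> B \<and> B \<subseteq> U)))"

definition smooth_manifold :: "('i, 'a, 'e::euclidean_space) riem_data \<Rightarrow> bool" where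
  "smooth_manifold M \<longleftrightarrow>
     Hausdorff_space (mtop M) \<and> second_countable_space (mtop M) \<and>
     (\<Union>i\<in>charts M. chart_dom M i) = topspace (mtop M) \<and>
     (\<forall>i\<in>charts M. openin (mtop M) (chart_dom M i) \<and> open (chart_img M i) \<and>
        homeomorphic_map (subtopology (mtop M) (chart_dom M i))
          (top_of_set (chart_img M i)) (chart M i)) \<and>
     (\<forall>i\<in>charts M. \<forall>j\<in>charts M.
        Cinf_on (chart M i ` (chart_dom M i \<inter> chart_dom M j)) (transition M i j))"

definition riemannian_metric :: "('i, 'a, 'e::euclidean_space) riem_data \<Rightarrow> bool" where
  "riemannian_metric M \<longleftrightarrow>
     (\<forall>i\<in>charts M.
        (\<forall>y\<in>chart_img M i. bilinear (metric M i y) \<and>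
           (\<forall>v w. metric M i y v w = metric M i y w v) \<and>
           (\<forall>v. v \<noteq> 0 \<longrightarrow> metric M i y v v > 0)) \<and>
        (\<forall>v w. Cinf_on (chart_img M i) (\<lambda>y. metric M i y v w))) \<and>
     (\<forall>i\<in>charts M. \<forall>j\<in>charts M. \<forall>x\<in>chart_dom M i \<inter> chart_dom M j. \<forall>v w.
        metric M i (chart M i x) v w =
        metric M j (chart M j x)
          (frechet_derivative (transition M i j) (at (chart M i x)) v)
          (frechet_derivative (transition M i j) (at (chart M i x)) w))"

definition riemannian_manifold :: "('i, 'a, 'e::euclidean_space) riem_data \<Rightarrow> bool" where
  "riemannian_manifold M \<longleftrightarrow>
     smooth_manifold M \<and> connected_space (mtop M) \<and> riemannian_metric M"

section \<open>Calculus in a chart\<close>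

text \<open>Here \<open>g\<close> is the metric tensor in one chart.\<close>

type_synonym 'e local_metric = "'e \<Rightarrow> 'e \<Rightarrow> 'e \<Rightarrow> real"

text \<open>The Christoffel symbols, as the vector-valued bilinear form
  \<open>\<Gamma>(v,w) = \<Sum>\<^sub>k \<Gamma>\<^sup>k(v,w) e\<^sub>k\<close>, given by Koszul's formula for coordinate fields.\<close>

definition christoffel :: "'e::euclidean_space local_metric \<Rightarrow> 'e \<Rightarrow> 'e \<Rightarrow> 'e \<Rightarrow> 'e" where
  "christoffel g y v w = (THE z. \<forall>x. 2 * g y z x =
      frechet_derivative (\<lambda>p. g p w x) (at y) v
    + frechet_derivative (\<lambda>p. g p v x) (at y) w
    - frechet_derivative (\<lambda>p. g p v w) (at y) x)"

definition covariant_deriv ::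
  "'e::euclidean_space local_metric \<Rightarrow> ('e \<Rightarrow> 'e) \<Rightarrow> ('e \<Rightarrow> 'e) \<Rightarrow> 'e \<Rightarrow> 'e" where
  "covariant_deriv g V X y =
     frechet_derivative X (at y) (V y) + christoffel g y (V y) (X y)"

text \<open>\<open>R(v,w)z = \<nabla>\<^sub>v \<nabla>\<^sub>w z - \<nabla>\<^sub>w \<nabla>\<^sub>v z\<close>; the term \<open>\<nabla>\<^bsub>[v,w]\<^esub> z\<close> vanishes because \<open>v\<close> and \<open>w\<close>
  are extended to fields with constant components.\<close>

definition curvature ::
  "'e::euclidean_space local_metric \<Rightarrow> 'e \<Rightarrow> 'e \<Rightarrow> 'e \<Rightarrow> 'e \<Rightarrow> 'e" where
  "curvature g y v w z =
     covariant_deriv g (\<lambda>_. v) (covariant_deriv g (\<lambda>_. w) (\<lambda>_. z)) y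
   - covariant_deriv g (\<lambda>_. w) (covariant_deriv g (\<lambda>_. v) (\<lambda>_. z)) y"

text \<open>The trace of \<open>v \<mapsto> R(v,w)z\<close>. With these signs round spheres have positive Ricci tensor.\<close>

definition ricci :: "'e::euclidean_space local_metric \<Rightarrow> 'e \<Rightarrow> 'e \<Rightarrow> 'e \<Rightarrow> real" where
  "ricci g y w z = (\<Sum>b\<in>Basis. curvature g y b w z \<bullet> b)"

definition gradient ::
  "'e::euclidean_space local_metric \<Rightarrow> ('e \<Rightarrow> real) \<Rightarrow> 'e \<Rightarrow> 'e" where
  "gradient g f y = (THE z. \<forall>v. g y z v = frechet_derivative f (at y) v)"

definition vec_length :: "'e local_metric \<Rightarrow> 'e \<Rightarrow> 'e \<Rightarrow> real" where
  "vec_length g y v = sqrt (g y v v)"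

text \<open>The trace of \<open>v \<mapsto> \<nabla>\<^sub>v X\<close>.\<close>

definition divergence ::
  "'e::euclidean_space local_metric \<Rightarrow> ('e \<Rightarrow> 'e) \<Rightarrow> 'e \<Rightarrow> real" where
  "divergence g X y = (\<Sum>b\<in>Basis. covariant_deriv g (\<lambda>_. b) X y \<bullet> b)"

section \<open>Notions on a Riemannian manifold\<close>

text \<open>The quantities above are invariant under change of chart, so pointwise conditions are
  imposed in all charts.\<close>

definition ricci_nonpositive :: "('i, 'a, 'e::euclidean_space) riem_data \<Rightarrow> bool" where
  "ricci_nonpositive M \<longleftrightarrow>
     (\<forall>i\<in>charts M. \<forall>y\<in>chart_img M i. \<forall>v. ricci (metric M i) y v v \<le> 0)"

definition smooth_function ::
  "('i, 'a, 'e::euclidean_space) riem_data \<Rightarrow> ('a \<Rightarrow> real) \<Rightarrow> bool" where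
  "smooth_function M u \<longleftrightarrow>
     (\<forall>i\<in>charts M. Cinf_on (chart_img M i) (u \<circ> chart_inv M i))"

definition grad :: "('i, 'a, 'e::euclidean_space) riem_data \<Rightarrow> ('a \<Rightarrow> real) \<Rightarrow> 'i \<Rightarrow> 'e \<Rightarrow> 'e" where
  "grad M u i = gradient (metric M i) (u \<circ> chart_inv M i)"

definition grad_length ::
  "('i, 'a, 'e::euclidean_space) riem_data \<Rightarrow> ('a \<Rightarrow> real) \<Rightarrow> 'i \<Rightarrow> 'e \<Rightarrow> real" where
  "grad_length M u i y = vec_length (metric M i) y (grad M u i y)"

definition bounded_gradient ::
  "('i, 'a, 'e::euclidean_space) riem_data \<Rightarrow> ('a \<Rightarrow> real) \<Rightarrow> bool" where
  "bounded_gradient M u \<longleftrightarrow>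
     (\<exists>C. \<forall>i\<in>charts M. \<forall>y\<in>chart_img M i. grad_length M u i y \<le> C)"

definition minimal_graph_equation ::
  "('i, 'a, 'e::euclidean_space) riem_data \<Rightarrow> ('a \<Rightarrow> real) \<Rightarrow> bool" where
  "minimal_graph_equation M u \<longleftrightarrow>
     (\<forall>i\<in>charts M. \<forall>y\<in>chart_img M i.
        divergence (metric M i)
          (\<lambda>p. (1 / sqrt (1 + (grad_length M u i p)\<^sup>2)) *\<^sub>R grad M u i p) y = 0)"

section \<open>Products\<close>

definition riem_line :: "(unit, real, real) riem_data" where
  "riem_line = \<lparr> mtop = euclidean, charts = UNIV, chart_dom = (\<lambda>_. UNIV),
     chart = (\<lambda>_ s. s), metric = (\<lambda>_ _ a b. a * b) \<rparr>"

definition riem_prod ::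
  "('i, 'a, 'd) riem_data \<Rightarrow> ('j, 'b, 'e) riem_data \<Rightarrow> ('i \<times> 'j, 'a \<times> 'b, 'd \<times> 'e) riem_data"
where
  "riem_prod M N =
     \<lparr> mtop = prod_topology (mtop M) (mtop N),
       charts = charts M \<times> charts N,
       chart_dom = (\<lambda>(i, j). chart_dom M i \<times> chart_dom N j),
       chart = (\<lambda>(i, j) (x, y). (chart M i x, chart N j y)),
       metric = (\<lambda>(i, j) (p, q) (v, w) (v', w'). metric M i p v v' + metric N j q w w') \<rparr>"

section \<open>Euler characteristic\<close>

text \<open>The rank of an abelian group in multiplicative notation. Only meaningful if the rank is
  finite, since the supremum is taken in \<open>nat\<close>.\<close>

definition int_independent :: "('a, 'b) monoid_scheme \<Rightarrow> 'a set \<Rightarrow> bool" where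
  "int_independent G S \<longleftrightarrow> finite S \<and> S \<subseteq> carrier G \<and>
     (\<forall>c :: 'a \<Rightarrow> int. finprod G (\<lambda>x. x [^]\<^bsub>G\<^esub> c x) S = \<one>\<^bsub>G\<^esub> \<longrightarrow> (\<forall>x\<in>S. c x = 0))"

definition group_rank :: "('a, 'b) monoid_scheme \<Rightarrow> nat" where
  "group_rank G = Sup {card S |S. int_independent G S}"

definition betti :: "nat \<Rightarrow> 'a topology \<Rightarrow> nat" where
  "betti p X = group_rank (homology_group (int p) X)"

text \<open>For a compact manifold all Betti numbers are finite and only finitely many are non-zero.\<close>

definition euler_characteristic :: "'a topology \<Rightarrow> int" where
  "euler_characteristic X = (\<Sum>p\<in>{p. betti p X \<noteq> 0}. (- 1) ^ p * int (betti p X))"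

end

theory Submission
  imports Defs
begin

text \<open>
  The proof compares \<open>u\<close> with the affine functions \<open>s \<mapsto> a s + b\<close> by means of the strong maximum
  principle.

  Written in non-divergence form, the equation reads
  \<open>(1 + |Du|\<^sup>2) \<Delta>u - Hess u(Du, Du) = 0\<close>. With the coefficients frozen at \<open>u\<close> it is linear and
  elliptic in the Hessian, and since \<open>s\<close> has vanishing Hessian in the product metric, each
  \<open>\<plusminus>u + k s\<close> solves the same linear equation (\<open>strong_maximum_principle_chart\<close>). Hopf's strong maximum
  principle (\<open>Hopf_strong_maximum_principle\<close>) therefore applies: on \<open>I \<times> F\<close> with an open
  interval \<open>I\<close> such a function attains its maximum only if it is constant.

  Let \<open>M(s)\<close> and \<open>m(s)\<close> be the maximum and the minimum of \<open>u\<close> over the compact slice \<open>{s} \<times> F\<close>. As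
  \<open>u - k s\<close> has no interior maximum on a slab unless it is constant, \<open>M\<close> is convex, and for the
  same reason \<open>m\<close> is concave (\<open>convex_slice_max\<close>). The bound on the gradient together with the
  compactness and connectedness of \<open>F\<close> bounds \<open>M - m\<close> uniformly
  (\<open>bounded_gradient_bounded_oscillation\<close>). A bounded convex function on the line is constant, so
  \<open>M = m + const\<close> is both convex and concave, hence \<open>M(s) = a s + b\<close>. Now \<open>u - a s\<close> attains its
  maximum \<open>b\<close> on \<open>\<real> \<times> F\<close>, in fact on each slice, and a last application of the strong maximum principle
  gives \<open>u = a s + b\<close> (\<open>bounded_gradient_imp_affine\<close>).

  Most of the work lies in the passage from the definitions in a chart to the linear equation. The
  inverse metric is shown to be differentiable by a resolvent identity; gradient and Christoffel
  symbols are expressed through it, and metric compatibility turns the divergence of the normalised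
  gradient into an expression in the Hessian (\<open>divergence_minimal_graph\<close>).
\<close>

section \<open>Linear algebra of inner products\<close>

definition inner_form :: "('e::euclidean_space \<Rightarrow> 'e \<Rightarrow> real) \<Rightarrow> bool" where
  "inner_form g \<longleftrightarrow> bilinear g \<and> (\<forall>v w. g v w = g w v) \<and> (\<forall>v. v \<noteq> 0 \<longrightarrow> g v v > 0)"

lemma bilinear_sum_left:
  assumes "bilinear g" shows "g (\<Sum>i\<in>I. c i *\<^sub>R f i) w = (\<Sum>i\<in>I. c i * g (f i) w)"
proof -
  have lin: "linear (\<lambda>v. g v w)" using assms by (simp add: bilinear_def)
  show ?thesis using linear_sum[OF lin, of "\<lambda>i. c i *\<^sub>R f i" I]
    by (simp add: linear_cmul[OF lin])
qed

lemma bilinear_sum_right: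
  assumes "bilinear g" shows "g w (\<Sum>i\<in>I. c i *\<^sub>R f i) = (\<Sum>i\<in>I. c i * g w (f i))"
proof -
  have lin: "linear (\<lambda>v. g w v)" using assms by (simp add: bilinear_def)
  show ?thesis using linear_sum[OF lin, of "\<lambda>i. c i *\<^sub>R f i" I]
    by (simp add: linear_cmul[OF lin])
qed

lemma bilinear_expand_right:
  fixes g :: "'e::euclidean_space \<Rightarrow> 'e \<Rightarrow> real"
  assumes "bilinear g" shows "g v w = (\<Sum>b\<in>Basis. (w \<bullet> b) * g v b)"
  using bilinear_sum_right[OF assms, of v "\<lambda>b. w \<bullet> b" "\<lambda>b. b" Basis] by (simp add: euclidean_representation)

lemma bilinear_expand_left:
  fixes g :: "'e::euclidean_space \<Rightarrow> 'e \<Rightarrow> real"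
  assumes "bilinear g" shows "g v w = (\<Sum>b\<in>Basis. (v \<bullet> b) * g b w)"
  using bilinear_sum_left[OF assms, of "\<lambda>b. v \<bullet> b" "\<lambda>b. b" Basis w] by (simp add: euclidean_representation)

lemma inner_form_nonneg:
  assumes "inner_form g" shows "g v v \<ge> 0"
  using assms by (cases "v = 0") (auto simp: inner_form_def bilinear_lzero less_imp_le)

lemma inner_form_eqI:
  assumes g: "inner_form g" and eq: "\<And>v. g z v = g z' v" shows "z = z'"
proof (rule ccontr)
  assume "z \<noteq> z'"
  then have "g (z - z') (z - z') > 0" using g by (simp add: inner_form_def)
  moreover have "g (z - z') v = 0" for v
    using bilinear_lsub[of g z z' v] eq[of v] g unfolding inner_form_def by simp
  ultimately show False by simp
qed

text \<open>
  Christoffel symbols and gradients are defined by a definite description of a vector with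
  prescribed inner products; this is what makes those descriptions meaningful.
\<close>

lemma inner_form_riesz:
  fixes g :: "'e::euclidean_space \<Rightarrow> 'e \<Rightarrow> real"
  assumes g: "inner_form g" and c: "linear c"
  shows "\<exists>!z. \<forall>v. g z v = c v"
proof -
  have bil: "bilinear g" using g by (simp add: inner_form_def)
  define T where "T z = (\<Sum>b\<in>Basis. g z b *\<^sub>R b)" for z
  have lin: "linear (\<lambda>z. g z b)" for b using bil by (simp add: bilinear_def)
  have linT: "linear T" unfolding T_def
    by (rule linearI) (simp_all add: linear_add[OF lin] linear_cmul[OF lin] scaleR_add_left sum.distrib scaleR_sum_right)
  have Tb: "T z \<bullet> v = g z v" for z v
    unfolding T_def bilinear_expand_right[OF bil, of z v]
    by (simp add: inner_sum_left inner_sum_right inner_commute mult.commute)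
  have "inj T"
    by (rule injI, rule inner_form_eqI[OF g]) (metis Tb)
  then have "surj T" using linT linear_injective_imp_surjective by blast
  then obtain z where z: "T z = (\<Sum>b\<in>Basis. c b *\<^sub>R b)" by (metis surjD)
  have "g z v = c v" for v
  proof -
    have "g z v = (\<Sum>b\<in>Basis. c b *\<^sub>R b) \<bullet> v" using Tb z by metis
    also have "\<dots> = c (\<Sum>b\<in>Basis. (v \<bullet> b) *\<^sub>R b)"
      by (simp only: linear_sum[OF c] linear_cmul[OF c])
         (simp add: inner_sum_left inner_sum_right inner_commute mult.commute)
    finally show ?thesis by (simp add: euclidean_representation)
  qed
  then show ?thesis using inner_form_eqI[OF g] by metis
qed

lemma inner_form_Cauchy_Schwarz:
  assumes g: "inner_form g" shows "(g v w)\<^sup>2 \<le> g v v * g w w"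
proof (cases "w = 0")
  case True
  have "g v w = 0" "g w w = 0"
    using True g by (auto simp: inner_form_def intro: bilinear_rzero)
  then show ?thesis by simp
next
  case False
  have bil: "bilinear g" and sym: "g v w = g w v" and p: "g w w > 0"
    using g False by (auto simp: inner_form_def)
  define t where "t = g v w / g w w"
  have "0 \<le> g (v - t *\<^sub>R w) (v - t *\<^sub>R w)" by (rule inner_form_nonneg[OF g])
  also have "\<dots> = g v v - 2 * t * g v w + t\<^sup>2 * g w w"
    using sym by (simp add: bilinear_lsub[OF bil] bilinear_rsub[OF bil] bilinear_lmul[OF bil]
      bilinear_rmul[OF bil] power2_eq_square algebra_simps)
  also have "\<dots> = g v v - (g v w)\<^sup>2 / g w w"
    using p by (simp add: t_def power2_eq_square field_simps)
  finally show ?thesis using p by (simp add: field_simps)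
qed

text \<open>
  Gram--Schmidt. The expansion of vectors is what is used later; orthonormality carries the
  induction.
\<close>

lemma inner_form_orthonormal_span:
  fixes g :: "'e::euclidean_space \<Rightarrow> 'e \<Rightarrow> real"
  assumes g: "inner_form g" and "finite A"
  shows "\<exists>T. finite T \<and> (\<forall>v \<in> span A. v = (\<Sum>e\<in>T. g v e *\<^sub>R e)) \<and>
    (\<forall>e\<in>T. \<forall>f\<in>T. g e f = (if e = f then 1 else 0))"
  using \<open>finite A\<close>
proof induction
  case empty
  show ?case by (rule exI[of _ "{}"]) simp
next
  case (insert x A)
  have bil: "bilinear g" and sym: "g v w = g w v" for v w
    using g by (auto simp: inner_form_def)
  obtain T where T: "finite T" "\<And>v. v \<in> span A \<Longrightarrow> v = (\<Sum>e\<in>T. g v e *\<^sub>R e)"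
    "\<And>e f. e \<in> T \<Longrightarrow> f \<in> T \<Longrightarrow> g e f = (if e = f then 1 else 0)" using insert.IH by blast
  define P where "P v = (\<Sum>e\<in>T. g v e *\<^sub>R e)" for v
  \<comment> \<open>\<open>P\<close> is the projection onto the span of \<open>A\<close>; only the part of \<open>x\<close> orthogonal to it adds a new direction.\<close>
  define y where "y = x - P x"
  have gP: "g (P v) f = g v f" if "f \<in> T" for v f
    unfolding P_def bilinear_sum_left[OF bil]
    using T(1) that by (simp add: T(3) if_distrib[of "\<lambda>t. _ * t"] sum.delta cong: if_cong sum.cong)
  have yT: "g y f = 0" if "f \<in> T" for f
    using gP[OF that] by (simp add: y_def bilinear_lsub[OF bil])
  have Plin: "P (v + k *\<^sub>R w) = P v + k *\<^sub>R P w" for v w k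
    by (simp add: P_def bilinear_ladd[OF bil] bilinear_lmul[OF bil] scaleR_add_left sum.distrib scaleR_sum_right)
  show ?case
  proof (cases "y = 0")
    case True
    have "v = P v" if vs: "v \<in> span (insert x A)" for v
    proof -
      obtain k where "v - k *\<^sub>R x \<in> span A" using vs unfolding span_breakdown_eq by blast
      then have "v - k *\<^sub>R x = P (v - k *\<^sub>R x)" using T(2) P_def by metis
      moreover have "P x = x" using True by (simp add: y_def)
      ultimately show ?thesis using Plin[of "v - k *\<^sub>R x" k x] by simp
    qed
    then show ?thesis using T unfolding P_def by blast
  next
    case False
    then have yy: "g y y > 0" using g by (simp add: inner_form_def)
    define e where "e = (1 / sqrt (g y y)) *\<^sub>R y"
    have ee: "g e e = 1" using yy by (simp add: e_def bilinear_lmul[OF bil] bilinear_rmul[OF bil])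
    have eT: "g e f = 0" "g f e = 0" if "f \<in> T" for f
      using yT[OF that] sym by (simp_all add: e_def bilinear_lmul[OF bil] bilinear_rmul[OF bil])
    have eni: "e \<notin> T" using eT ee by force
    have y: "y = sqrt (g y y) *\<^sub>R e" using yy by (simp add: e_def)
    have "v = (\<Sum>f\<in>insert e T. g v f *\<^sub>R f)" if vs: "v \<in> span (insert x A)" for v
    proof -
      obtain k where k: "v - k *\<^sub>R x \<in> span A" using vs unfolding span_breakdown_eq by blast
      have "v - k *\<^sub>R x = P (v - k *\<^sub>R x)" using T(2)[OF k] P_def by metis
      then have v: "v = P v + k *\<^sub>R y" using Plin[of "v - k *\<^sub>R x" k x] by (simp add: y_def algebra_simps)
      have "g (P v) e = 0"
        unfolding P_def bilinear_sum_left[OF bil] by (simp add: eT)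
      then have "g v e = k * g y e"
        by (subst v) (simp add: bilinear_ladd[OF bil] bilinear_lmul[OF bil])
      also have "g y e = sqrt (g y y)"
        by (subst y) (simp add: bilinear_lmul[OF bil] ee)
      finally have "g v e *\<^sub>R e = k *\<^sub>R y" by (subst y) simp
      then show ?thesis using v eni T(1) by (simp add: P_def add.commute)
    qed
    moreover have "g e1 e2 = (if e1 = e2 then 1 else 0)" if "e1 \<in> insert e T" "e2 \<in> insert e T" for e1 e2
      using that T(3) ee eT eni by auto
    ultimately show ?thesis using T(1) by (intro exI[of _ "insert e T"]) auto
  qed
qed

text \<open>
  Expanding in a basis that is orthonormal for \<open>(v, w) \<mapsto> v \<bullet> a w\<close> and applying \<open>a\<close> writes
  the operator as a sum of rank-one squares, without any spectral theorem.
\<close>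

lemma positive_operator_sum_of_squares:
  fixes a :: "'e::euclidean_space \<Rightarrow> 'e"
  assumes lin: "linear a" and sym: "\<And>v w. a v \<bullet> w = v \<bullet> a w" and pos: "\<And>v. v \<noteq> 0 \<Longrightarrow> v \<bullet> a v > 0"
  shows "\<exists>T h. finite (T::'e set) \<and> (\<forall>v. a v = (\<Sum>e\<in>T. (v \<bullet> h e) *\<^sub>R h e))"
proof -
  define g where "g v w = v \<bullet> a w" for v w
  have "bilinear g"
    unfolding bilinear_def g_def
    by (auto intro!: linearI simp: linear_add[OF lin] linear_cmul[OF lin] inner_simps)
  then have "inner_form g"
    using sym pos by (auto simp: inner_form_def g_def inner_commute)
  from inner_form_orthonormal_span[OF this finite_Basis]
  obtain T where T: "finite T" "\<And>v. v = (\<Sum>e\<in>T. g v e *\<^sub>R e)" by auto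
  have "a v = (\<Sum>e\<in>T. (v \<bullet> a e) *\<^sub>R a e)" for v
    by (subst T(2)[of v]) (simp add: linear_sum[OF lin] linear_cmul[OF lin] g_def)
  then show ?thesis using T(1) by blast
qed

text \<open>
  The sum over the basis is the trace of the product of a positive and a non-positive form.
  Such a product need not be symmetric, but writing \<open>a\<close> as a sum of squares turns its trace into
  a sum of values of \<open>H\<close> on the diagonal. This is the algebraic core of the maximum principle.
\<close>

lemma trace_positive_negative_le_0:
  fixes a :: "'e::euclidean_space \<Rightarrow> 'e"
  assumes a: "linear a" "\<And>v w. a v \<bullet> w = v \<bullet> a w" "\<And>v. v \<noteq> 0 \<Longrightarrow> v \<bullet> a v > 0"
    and H: "bilinear H" "\<And>v. H v v \<le> (0::real)"
  shows "(\<Sum>b\<in>Basis. H b (a b)) \<le> 0"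
proof -
  obtain T :: "'e set" and h where T: "\<And>v. a v = (\<Sum>e\<in>T. (v \<bullet> h e) *\<^sub>R h e)"
    using positive_operator_sum_of_squares[OF a] by auto
  have "(\<Sum>b\<in>Basis. H b (a b)) = (\<Sum>b\<in>Basis. \<Sum>e\<in>T. (b \<bullet> h e) * H b (h e))"
    by (simp add: T bilinear_sum_right[OF H(1)])
  also have "\<dots> = (\<Sum>e\<in>T. \<Sum>b\<in>Basis. (h e \<bullet> b) * H b (h e))"
    by (subst sum.swap) (simp add: inner_commute)
  also have "\<dots> = (\<Sum>e\<in>T. H (h e) (h e))"
    by (simp add: bilinear_expand_left[OF H(1), symmetric])
  also have "\<dots> \<le> 0" by (simp add: H(2) sum_nonpos)
  finally show ?thesis .
qed

section \<open>Hopf's strong maximum principle\<close>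

text \<open>
  The one-variable second derivative test along the line through \<open>x\<close> in direction \<open>v\<close>.
\<close>

lemma second_derivative_nonpos_at_max:
  fixes w :: "'e::euclidean_space \<Rightarrow> real"
  assumes S: "open S" "x \<in> S"
    and D: "\<And>y. y \<in> S \<Longrightarrow> (w has_derivative D y) (at y)"
    and D2: "((\<lambda>y. D y v) has_derivative (\<lambda>h. D2 h)) (at x)"
    and max: "\<And>y. y \<in> S \<Longrightarrow> w y \<le> w x"
  shows "D x v = 0" and "D2 v \<le> 0"
proof -
  define \<gamma> where "\<gamma> t = x + t *\<^sub>R v" for t :: real
  have g0: "\<gamma> 0 = x" by (simp add: \<gamma>_def)
  have g': "(\<gamma> has_derivative (\<lambda>t. t *\<^sub>R v)) (at t)" for t
    unfolding \<gamma>_def by (auto intro!: derivative_eq_intros)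
  have "open (\<gamma> -` S)"
    using S(1) unfolding \<gamma>_def by (intro open_vimage) (auto intro!: continuous_intros)
  moreover have "0 \<in> \<gamma> -` S" using S g0 by simp
  ultimately obtain r where r: "r > 0" "ball 0 r \<subseteq> \<gamma> -` S" using openE by blast
  have rS: "\<gamma> t \<in> S" if "\<bar>t\<bar> < r" for t using r that by (auto simp: subset_iff dist_norm)
  have d1: "((\<lambda>t. w (\<gamma> t)) has_real_derivative D (\<gamma> t) v) (at t)" if "\<bar>t\<bar> < r" for t
  proof -
    have "((\<lambda>t. w (\<gamma> t)) has_derivative (\<lambda>h. D (\<gamma> t) (h *\<^sub>R v))) (at t)"
      using has_derivative_compose[OF g' D[OF rS[OF that]]] .
    moreover have "D (\<gamma> t) (h *\<^sub>R v) = D (\<gamma> t) v * h" for h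
      using has_derivative_linear[OF D[OF rS[OF that]]] by (simp add: linear_cmul)
    ultimately show ?thesis by (simp add: has_field_derivative_def)
  qed
  have d2: "((\<lambda>t. D (\<gamma> t) v) has_real_derivative D2 v) (at 0)"
  proof -
    have "((\<lambda>t. D (\<gamma> t) v) has_derivative (\<lambda>h. D2 (h *\<^sub>R v))) (at 0)"
      using has_derivative_compose[OF g'[of 0], of "\<lambda>y. D y v" D2] D2 g0 by simp
    moreover have "D2 (h *\<^sub>R v) = D2 v * h" for h
      using has_derivative_linear[OF D2] by (simp add: linear_cmul)
    ultimately show ?thesis by (simp add: has_field_derivative_def)
  qed
  show z: "D x v = 0"
  proof -
    have "D (\<gamma> 0) v = 0"
      by (rule DERIV_local_max[OF d1[of 0] \<open>r > 0\<close>]) (use \<open>r > 0\<close> max rS g0 in auto)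
    then show ?thesis by (simp add: g0)
  qed
  show "D2 v \<le> 0"
  proof (rule ccontr)
    assume "\<not> D2 v \<le> 0"
    then obtain d where d: "d > 0" "\<And>h. 0 < h \<Longrightarrow> h < d \<Longrightarrow> D (\<gamma> 0) v < D (\<gamma> (0 + h)) v"
      using DERIV_pos_inc_right[OF d2] by auto
    define t where "t = min d r / 2"
    have t: "0 < t" "t < d" "t < r" using d r by (auto simp: t_def)
    have "w (\<gamma> 0) < w (\<gamma> t)"
    proof (rule DERIV_pos_imp_increasing_open[OF t(1)])
      fix s assume "0 < s" "s < t"
      then show "\<exists>y. DERIV (\<lambda>t. w (\<gamma> t)) s :> y \<and> y > 0"
        using d1[of s] d(2)[of s] t z g0 by (intro exI[of _ "D (\<gamma> s) v"]) auto
    next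
      show "continuous_on {0..t} (\<lambda>t. w (\<gamma> t))"
        using t by (intro continuous_at_imp_continuous_on ballI DERIV_isCont[OF d1]) auto
    qed
    then show False using max[of "\<gamma> t"] rS[of t] t g0 by auto
  qed
qed

text \<open>
  The classical barrier is a Gaussian centred at \<open>q\<close>. The first term of its second derivative
  is quadratic in \<open>\<alpha>\<close>. Contracted with positive definite coefficients it is positive away from
  \<open>q\<close>, and for large \<open>\<alpha>\<close> it dominates all other terms.
\<close>

lemma Hopf_barrier:
  fixes q :: "'e::euclidean_space" and \<alpha> :: real
  defines "E \<equiv> \<lambda>x. exp (- \<alpha> * ((x - q) \<bullet> (x - q)))"
  defines "DE \<equiv> \<lambda>x v. - 2 * \<alpha> * ((x - q) \<bullet> v) * E x"
  defines "D2E \<equiv> \<lambda>x h v. E x * (4 * \<alpha>\<^sup>2 * ((x - q) \<bullet> h) * ((x - q) \<bullet> v) - 2 * \<alpha> * (h \<bullet> v))"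
  shows "(E has_derivative DE x) (at x)"
    and "((\<lambda>y. DE y v) has_derivative (\<lambda>h. D2E x h v)) (at x)"
proof -
  show E: "(E has_derivative DE x) (at x)" for x
    unfolding E_def DE_def by (auto intro!: derivative_eq_intros ext simp: inner_commute algebra_simps)
  show "((\<lambda>y. DE y v) has_derivative (\<lambda>h. D2E x h v)) (at x)"
    unfolding DE_def
    by (rule derivative_eq_intros E refl ext)+
       (simp add: D2E_def DE_def inner_commute algebra_simps power2_eq_square)
qed

text \<open>
  The operator is \<open>L w = \<Sum>\<^sub>b D\<^sup>2w(b, a b) + Dw(B)\<close>. If \<open>w\<close> is not constant near \<open>p\<close>, there is
  a ball in which \<open>w < m\<close> and whose boundary meets \<open>{w = m}\<close> in exactly one point \<open>p'\<close>.
  For a Gaussian \<open>E\<close> centred at the centre of that ball and steep enough, \<open>L E > 0\<close> near \<open>p'\<close>. Adding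
  a small multiple of \<open>E - E(p')\<close> to \<open>w\<close> keeps the values on a small sphere around \<open>p'\<close> below
  \<open>m\<close>: inside the touching ball \<open>w\<close> is smaller than \<open>m\<close> by a fixed amount, outside it the
  perturbation is negative. So the perturbed function has an interior maximum in the small
  ball, where the value of \<open>L\<close> cannot be positive; but it is.
\<close>

lemma Hopf_strong_maximum_principle:
  fixes w :: "'e::euclidean_space \<Rightarrow> real"
  assumes S: "open S" "p \<in> S"
    and D: "\<And>x. x \<in> S \<Longrightarrow> (w has_derivative D x) (at x)"
    and H: "\<And>x v. x \<in> S \<Longrightarrow> ((\<lambda>y. D y v) has_derivative (\<lambda>h. H x h v)) (at x)"
    and bil: "\<And>x. x \<in> S \<Longrightarrow> bilinear (H x)"
    and a: "\<And>x. x \<in> S \<Longrightarrow> linear (a x)" "\<And>x v w. x \<in> S \<Longrightarrow> a x v \<bullet> w = v \<bullet> a x w"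
      "\<And>x v. x \<in> S \<Longrightarrow> v \<noteq> 0 \<Longrightarrow> v \<bullet> a x v > 0"
    and cont: "\<And>v. continuous_on S (\<lambda>x. a x v)" "continuous_on S B"
    and eq: "\<And>x. x \<in> S \<Longrightarrow> (\<Sum>b\<in>Basis. H x b (a x b)) + D x (B x) = 0"
    and max: "\<And>x. x \<in> S \<Longrightarrow> w x \<le> m" "w p = m"
  shows "\<exists>r>0. ball p r \<subseteq> S \<and> (\<forall>x\<in>ball p r. w x = m)"
proof -
  have wcont: "continuous_on S w"
    using D by (meson continuous_at_imp_continuous_on has_derivative_continuous)
  obtain r0 where r0: "r0 > 0" "ball p r0 \<subseteq> S" using openE[OF S] .
  have "w q = m" if q: "q \<in> ball p (r0 / 2)" for q
  proof (rule ccontr)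
    assume wq: "w q \<noteq> m"
    have sub: "cball q (dist q p) \<subseteq> S"
    proof
      fix x assume "x \<in> cball q (dist q p)"
      then have "dist p x < r0" using q dist_triangle[of p x q] by (simp add: dist_commute)
      then show "x \<in> S" using r0 by auto
    qed
    define K where "K = cball q (dist q p) \<inter> w -` {m}"
    have "closed K" unfolding K_def
      by (rule continuous_closed_preimage) (auto intro: continuous_on_subset[OF wcont sub])
    moreover have "p \<in> K" by (simp add: K_def max)
    ultimately obtain p' where p': "p' \<in> K" "\<And>y. y \<in> K \<Longrightarrow> dist q p' \<le> dist q y"
      using distance_attains_inf[of K q] by blast
    have p'S: "p' \<in> S" "w p' = m" using p' sub by (auto simp: K_def)
    have less: "w x < m" if "dist q x < dist q p'" for x
    proof -
      have "dist q x \<le> dist q p" using that p'(1) by (simp add: K_def)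
      then have "x \<in> S" using sub by auto
      moreover have "w x \<noteq> m" using that p'(2)[of x] \<open>dist q x \<le> dist q p\<close> by (auto simp: K_def)
      ultimately show ?thesis using max(1)[of x] by simp
    qed
    have ne: "p' \<noteq> q" using p'S wq by auto
    \<comment> \<open>The ball around \<open>q\<close> may touch \<open>{w = m}\<close> in many points; the ball of half the radius that is internally tangent at \<open>p'\<close> touches it only there.\<close>
    define c where "c = midpoint q p'"
    define R where "R = dist q p' / 2"
    have R: "R > 0" "dist q c = R" "dist c p' = R"
      using ne by (auto simp: R_def c_def dist_midpoint)
    have less': "w x < m" if "dist c x \<le> R" "x \<noteq> p'" for x
    proof (cases "dist q x < dist q p'")
      case False
      moreover have "dist q x \<le> dist q c + dist c x" by (rule dist_triangle)
      ultimately have "dist q x = 2 * R" "dist c x = R" using that(1) R by (auto simp: R_def)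
      then have "norm (x - c) = R" "norm (c - q) = R" "norm ((x - c) + (c - q)) = norm (x - c) + norm (c - q)"
        using R by (auto simp: dist_norm norm_minus_commute)
      then have "R *\<^sub>R (c - q) = R *\<^sub>R (x - c)"
        using norm_triangle_eq[of "x - c" "c - q"] by simp
      then have "c - q = x - c" using R(1) by (metis order_less_irrefl real_vector.scale_left_imp_eq)
      then have "x = c + (c - q)" by simp
      also have "\<dots> = p'" by (simp add: c_def midpoint_def algebra_simps flip: scaleR_2)
      finally show ?thesis using that by simp
    qed (rule less)
    define \<xi> where "\<xi> = p' - c"
    have "\<xi> \<noteq> 0" using R by (auto simp: \<xi>_def)
    then have pos: "\<xi> \<bullet> a p' \<xi> > 0" using a(3)[OF p'S(1)] by simp
    define \<beta> where "\<beta> x = (\<Sum>b\<in>Basis. b \<bullet> a x b) + (x - c) \<bullet> B x" for x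
    \<comment> \<open>At \<open>p'\<close> the sign of \<open>L E\<close> is that of \<open>2 \<alpha> (\<xi> \<bullet> a \<xi>) - \<beta>\<close>.\<close>
    define \<alpha> where "\<alpha> = (\<bar>\<beta> p'\<bar> + 1) / (\<xi> \<bullet> a p' \<xi>)"
    have \<alpha>: "\<alpha> > 0" using pos by (simp add: \<alpha>_def)
    define E where "E x = exp (- \<alpha> * ((x - c) \<bullet> (x - c)))" for x
    define DE where "DE x v = - 2 * \<alpha> * ((x - c) \<bullet> v) * E x" for x v
    define D2E where "D2E x h v = E x * (4 * \<alpha>\<^sup>2 * ((x - c) \<bullet> h) * ((x - c) \<bullet> v) - 2 * \<alpha> * (h \<bullet> v))" for x h v
    note barrier = Hopf_barrier[of \<alpha> c, folded E_def, folded DE_def D2E_def]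
    define LE where "LE x = (\<Sum>b\<in>Basis. D2E x b (a x b)) + DE x (B x)" for x
    have LE: "LE x = 2 * \<alpha> * E x * (2 * \<alpha> * (\<Sum>b\<in>Basis. ((x - c) \<bullet> b) * ((x - c) \<bullet> a x b)) - \<beta> x)" for x
      unfolding LE_def D2E_def DE_def \<beta>_def
      by (simp add: algebra_simps sum_distrib_left sum_subtractf sum.distrib power2_eq_square)
    have "LE p' = 2 * \<alpha> * E p' * (2 * \<alpha> * (\<xi> \<bullet> a p' \<xi>) - \<beta> p')"
    proof -
      have "\<xi> \<bullet> a p' \<xi> = \<xi> \<bullet> a p' (\<Sum>b\<in>Basis. (\<xi> \<bullet> b) *\<^sub>R b)" by (simp add: euclidean_representation)
      also have "\<dots> = (\<Sum>b\<in>Basis. (\<xi> \<bullet> b) * (\<xi> \<bullet> a p' b))"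
        by (simp only: linear_sum[OF a(1)[OF p'S(1)]] linear_cmul[OF a(1)[OF p'S(1)]])
           (simp add: inner_sum_right)
      finally show ?thesis unfolding LE by (simp add: \<xi>_def)
    qed
    moreover have "2 * \<alpha> * (\<xi> \<bullet> a p' \<xi>) - \<beta> p' > 0"
      using pos by (simp add: \<alpha>_def)
    ultimately have LEp: "LE p' > 0" using \<alpha> by (simp add: E_def)
    have "continuous_on S LE"
      unfolding LE_def DE_def D2E_def E_def using cont by (intro continuous_intros) auto
    then have "open (S \<inter> LE -` {0<..})"
      using continuous_open_preimage[OF _ S(1) open_greaterThan] by blast
    moreover have "p' \<in> S \<inter> LE -` {0<..}" using p'S LEp by simp
    ultimately obtain \<delta>0 where "\<delta>0 > 0" "ball p' \<delta>0 \<subseteq> S \<inter> LE -` {0<..}" using openE by blast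
    define \<delta> where "\<delta> = \<delta>0 / 2"
    have \<delta>: "\<delta> > 0" "cball p' \<delta> \<subseteq> S" "\<And>x. x \<in> cball p' \<delta> \<Longrightarrow> LE x > 0"
      using \<open>\<delta>0 > 0\<close> \<open>ball p' \<delta>0 \<subseteq> _\<close> by (auto simp: \<delta>_def subset_iff)
    define C where "C = sphere p' \<delta> \<inter> cball c R"
    have "\<exists>\<eta>>0. \<forall>x\<in>C. w x \<le> m - \<eta>"
    proof (cases "C = {}")
      case False
      have "compact C" unfolding C_def by (intro compact_Int_closed) auto
      moreover have "continuous_on C w"
        using wcont \<delta>(2) unfolding C_def by (meson continuous_on_subset inf_le1 sphere_cball subset_trans)
      ultimately obtain z where z: "z \<in> C" "\<And>x. x \<in> C \<Longrightarrow> w x \<le> w z"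
        using continuous_attains_sup[of C w] False by blast
      have "w z < m" using z(1) \<delta>(1) by (intro less') (auto simp: C_def)
      then show ?thesis using z(2) by (intro exI[of _ "m - w z"]) auto
    qed (auto intro: exI[of _ 1])
    then obtain \<eta> where \<eta>: "\<eta> > 0" "\<And>x. x \<in> C \<Longrightarrow> w x \<le> m - \<eta>" by blast
    \<comment> \<open>On \<open>C\<close> the perturbation adds at most \<open>\<epsilon>\<close>, since \<open>E\<close> takes values in \<open>(0, 1]\<close>.\<close>
    define \<epsilon> where "\<epsilon> = \<eta> / 2"
    define e0 where "e0 = E p'"
    define v where "v x = w x + \<epsilon> * (E x - e0)" for x
    have Elt: "E x < e0" if "dist c x > R" for x
    proof -
      have "norm (p' - c) < norm (x - c)" using that R by (simp add: dist_norm norm_minus_commute)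
      then have "(p' - c) \<bullet> (p' - c) < (x - c) \<bullet> (x - c)"
        by (simp add: dot_square_norm power_strict_mono)
      then show ?thesis using \<alpha> by (simp add: E_def e0_def)
    qed
    have bdry: "v x < m" if "x \<in> sphere p' \<delta>" for x
    proof (cases "dist c x \<le> R")
      case True
      then have "w x \<le> m - \<eta>" using that by (intro \<eta>) (auto simp: C_def)
      moreover have "E x \<le> 1" "e0 > 0" using \<alpha> by (auto simp: E_def e0_def)
      then have "\<epsilon> * (E x - e0) \<le> \<epsilon> * 1" using \<eta>(1) by (intro mult_left_mono) (auto simp: \<epsilon>_def)
      ultimately show ?thesis using \<eta>(1) unfolding v_def \<epsilon>_def by linarith
    next
      case False
      then have "\<epsilon> * (E x - e0) < 0" using Elt[of x] \<eta>(1) by (simp add: \<epsilon>_def mult_pos_neg)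
      moreover have "w x \<le> m" using that \<delta>(2) sphere_cball by (intro max) blast
      ultimately show ?thesis by (simp add: v_def)
    qed
    have "continuous_on (cball p' \<delta>) v"
      unfolding v_def E_def using continuous_on_subset[OF wcont \<delta>(2)] by (intro continuous_intros) auto
    then obtain z where z: "z \<in> cball p' \<delta>" "\<And>x. x \<in> cball p' \<delta> \<Longrightarrow> v x \<le> v z"
      using continuous_attains_sup[of "cball p' \<delta>" v] \<delta>(1) by auto
    have "m \<le> v z" using z(2)[of p'] \<delta>(1) p'S by (simp add: v_def e0_def)
    then have zb: "z \<in> ball p' \<delta>" using bdry[of z] z(1) by (cases "dist p' z = \<delta>") auto
    have zS: "z \<in> S" using z \<delta> by auto
    define Dv where "Dv x h = D x h + \<epsilon> * DE x h" for x h
    define D2v where "D2v x h k = H x h k + \<epsilon> * D2E x h k" for x h k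
    have Dv: "(v has_derivative Dv x) (at x)" if "x \<in> ball p' \<delta>" for x
    proof -
      have "x \<in> S" using that \<delta>(2) by auto
      then show ?thesis unfolding v_def Dv_def
        by (auto intro!: derivative_eq_intros D barrier(1))
    qed
    have D2v: "((\<lambda>y. Dv y k) has_derivative (\<lambda>h. D2v z h k)) (at z)" for k
      unfolding Dv_def D2v_def by (auto intro!: derivative_eq_intros H zS barrier(2))
    have crit: "Dv z k = 0" "D2v z k k \<le> 0" for k
      using second_derivative_nonpos_at_max[OF open_ball zb Dv D2v] z(2) by auto
    have "bilinear (D2v z)"
      using bil[OF zS] unfolding bilinear_def D2v_def D2E_def
      by (auto simp: linear_iff inner_simps algebra_simps)
    then have "(\<Sum>b\<in>Basis. D2v z b (a z b)) \<le> 0"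
      using a zS crit(2) by (intro trace_positive_negative_le_0) auto
    then have "(\<Sum>b\<in>Basis. D2v z b (a z b)) + Dv z (B z) \<le> 0" using crit(1) by simp
    also have "(\<Sum>b\<in>Basis. D2v z b (a z b)) + Dv z (B z) =
        ((\<Sum>b\<in>Basis. H z b (a z b)) + D z (B z)) + \<epsilon> * LE z"
      by (simp add: D2v_def Dv_def LE_def sum.distrib algebra_simps sum_distrib_left)
    also have "\<dots> = \<epsilon> * LE z" using eq[OF zS] by simp
    finally show False using \<delta>(3)[OF z(1)] \<eta>(1) by (simp add: \<epsilon>_def mult_le_0_iff)
  qed
  moreover have "ball p (r0 / 2) \<subseteq> S" using r0 by auto
  ultimately show ?thesis using r0(1) by (intro exI[of _ "r0 / 2"]) auto
qed

section \<open>The metric in a chart and its inverse\<close>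

text \<open>
  A product rule in which the second factor is merely continuous; this suffices because the first
  factor vanishes at the point. It upgrades continuity of the inverse metric to differentiability.
\<close>

lemma has_derivative_scaleR_vanishing:
  fixes k :: "'a::real_normed_vector \<Rightarrow> real" and f :: "'a \<Rightarrow> 'b::real_normed_vector"
  assumes k: "(k has_derivative k') (at y)" "k y = 0" and f: "isCont f y"
  shows "((\<lambda>p. k p *\<^sub>R f p) has_derivative (\<lambda>h. k' h *\<^sub>R f y)) (at y)"
proof -
  have "((\<lambda>p. k p *\<^sub>R (f p - f y)) has_derivative (\<lambda>h. 0)) (at y)"
    unfolding has_derivative_within
  proof (intro conjI)
    show "bounded_linear (\<lambda>h::'a. 0::'b)" by simp
    obtain K where K: "\<And>h. norm (k' h) \<le> norm h * K" "K > 0"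
      using bounded_linear.pos_bounded[OF has_derivative_bounded_linear[OF k(1)]] by blast
    define e where "e p = (k p - k' (p - y)) / norm (p - y)" for p
    have e: "(e \<longlongrightarrow> 0) (at y)"
    proof -
      have "((\<lambda>p. (1 / norm (p - y)) *\<^sub>R (k p - (k y + k' (p - y)))) \<longlongrightarrow> 0) (at y)"
        using k(1) unfolding has_derivative_within by (rule conjunct2)
      then show ?thesis by (simp add: e_def[abs_def] k(2) divide_inverse mult.commute)
    qed
    have fy: "((\<lambda>p. norm (f p - f y)) \<longlongrightarrow> 0) (at y)"
      using f by (simp add: isCont_def LIM_zero tendsto_norm_zero)
    have "((\<lambda>p. (\<bar>e p\<bar> + K) * norm (f p - f y)) \<longlongrightarrow> (\<bar>0\<bar> + K) * 0) (at y)"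
      by (intro tendsto_intros e fy)
    then have lim: "((\<lambda>p. (\<bar>e p\<bar> + K) * norm (f p - f y)) \<longlongrightarrow> 0) (at y)" by simp
    show "((\<lambda>p. (1 / norm (p - y)) *\<^sub>R (k p *\<^sub>R (f p - f y) - (k y *\<^sub>R (f y - f y) + 0))) \<longlongrightarrow> 0) (at y)"
    proof (rule Lim_null_comparison[OF _ lim])
      show "\<forall>\<^sub>F p in at y. norm ((1 / norm (p - y)) *\<^sub>R (k p *\<^sub>R (f p - f y) - (k y *\<^sub>R (f y - f y) + 0)))
          \<le> (\<bar>e p\<bar> + K) * norm (f p - f y)"
      proof (rule eventually_at_topological[THEN iffD2], intro exI[of _ UNIV] conjI ballI impI)
        fix p assume "p \<noteq> y"
        then have n: "norm (p - y) > 0" by simp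
        have "k p = e p * norm (p - y) + k' (p - y)" using n by (simp add: e_def)
        then have "\<bar>k p\<bar> \<le> \<bar>e p\<bar> * norm (p - y) + \<bar>k' (p - y)\<bar>"
          by (metis abs_mult abs_norm_cancel abs_triangle_ineq)
        also have "\<dots> \<le> \<bar>e p\<bar> * norm (p - y) + norm (p - y) * K" using K(1)[of "p - y"] by simp
        finally have "\<bar>k p\<bar> / norm (p - y) \<le> \<bar>e p\<bar> + K" using n by (simp add: field_simps)
        then have "\<bar>k p\<bar> / norm (p - y) * norm (f p - f y) \<le> (\<bar>e p\<bar> + K) * norm (f p - f y)"
          by (rule mult_right_mono) simp
        then show "norm ((1 / norm (p - y)) *\<^sub>R (k p *\<^sub>R (f p - f y) - (k y *\<^sub>R (f y - f y) + 0)))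
          \<le> (\<bar>e p\<bar> + K) * norm (f p - f y)" by simp
      qed auto
    qed
  qed
  moreover have "((\<lambda>p. k p *\<^sub>R f y) has_derivative (\<lambda>h. k' h *\<^sub>R f y)) (at y)"
    by (intro has_derivative_scaleR_left k)
  ultimately have "((\<lambda>p. k p *\<^sub>R f y + k p *\<^sub>R (f p - f y)) has_derivative (\<lambda>h. k' h *\<^sub>R f y + 0)) (at y)"
    by (rule has_derivative_add[rotated])
  then show ?thesis by (simp add: scaleR_diff_right)
qed

locale metric_chart =
  fixes S :: "'e::euclidean_space set" and g :: "'e local_metric"
  assumes open_S: "open S"
    and inner: "y \<in> S \<Longrightarrow> inner_form (g y)"
    and differentiable_g: "y \<in> S \<Longrightarrow> (\<lambda>p. g p v w) differentiable (at y)"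
    and continuous_Dg: "continuous_on S (\<lambda>y. frechet_derivative (\<lambda>p. g p v w) (at y) z)"
begin

definition Dg :: "'e \<Rightarrow> 'e \<Rightarrow> 'e \<Rightarrow> 'e \<Rightarrow> real" where
  "Dg y z v w = frechet_derivative (\<lambda>p. g p v w) (at y) z"

lemma bil: "y \<in> S \<Longrightarrow> bilinear (g y)" and sym: "y \<in> S \<Longrightarrow> g y v w = g y w v"
  using inner by (auto simp: inner_form_def)

lemma has_derivative_g:
  assumes "y \<in> S" shows "((\<lambda>p. g p v w) has_derivative (\<lambda>z. Dg y z v w)) (at y)"
  using differentiable_g[OF assms] unfolding Dg_def by (simp add: frechet_derivative_works eta_contract_eq)

lemma linear_Dg: "y \<in> S \<Longrightarrow> linear (\<lambda>z. Dg y z v w)"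
  using has_derivative_g has_derivative_linear by blast

lemma g_expand:
  assumes "y \<in> S"
  shows "g y v w = (\<Sum>b\<in>Basis. \<Sum>b'\<in>Basis. (v \<bullet> b) * ((w \<bullet> b') * g y b b'))"
  unfolding bilinear_expand_left[OF bil[OF assms], of v w]
  by (subst bilinear_expand_right[OF bil[OF assms]]) (simp add: sum_distrib_left)

text \<open>
  The metric is differentiated in components, because smoothness is only assumed for the
  functions \<open>p \<mapsto> g p v w\<close> with fixed vectors. With constant fields the lemma shows that the
  derivative of the metric is itself given by its components, hence bilinear.
\<close>

lemma metric_product_rule_in_components:
  assumes y: "y \<in> S" and X: "(X has_derivative X') (at y)" and Y: "(Y has_derivative Y') (at y)"
  shows "((\<lambda>p. g p (X p) (Y p)) has_derivative
    (\<lambda>z. (\<Sum>b\<in>Basis. \<Sum>b'\<in>Basis. (X y \<bullet> b) * ((Y y \<bullet> b') * Dg y z b b'))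
       + g y (X' z) (Y y) + g y (X y) (Y' z))) (at y)"
proof -
  have "((\<lambda>p. \<Sum>b\<in>Basis. \<Sum>b'\<in>Basis. (X p \<bullet> b) * ((Y p \<bullet> b') * g p b b')) has_derivative
    (\<lambda>z. \<Sum>b\<in>Basis. \<Sum>b'\<in>Basis. (X y \<bullet> b) * ((Y y \<bullet> b') * Dg y z b b' + (Y' z \<bullet> b') * g y b b')
        + (X' z \<bullet> b) * ((Y y \<bullet> b') * g y b b'))) (at y)"
    by (intro has_derivative_sum has_derivative_mult has_derivative_inner_left X Y has_derivative_g y)
  then have "((\<lambda>p. g p (X p) (Y p)) has_derivative
    (\<lambda>z. \<Sum>b\<in>Basis. \<Sum>b'\<in>Basis. (X y \<bullet> b) * ((Y y \<bullet> b') * Dg y z b b' + (Y' z \<bullet> b') * g y b b')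
        + (X' z \<bullet> b) * ((Y y \<bullet> b') * g y b b'))) (at y)"
    by (rule has_derivative_transform_within_open[OF _ open_S y]) (simp add: g_expand)
  moreover have "(\<Sum>b\<in>Basis. \<Sum>b'\<in>Basis. (X y \<bullet> b) * ((Y y \<bullet> b') * Dg y z b b' + (Y' z \<bullet> b') * g y b b')
        + (X' z \<bullet> b) * ((Y y \<bullet> b') * g y b b'))
      = (\<Sum>b\<in>Basis. \<Sum>b'\<in>Basis. (X y \<bullet> b) * ((Y y \<bullet> b') * Dg y z b b'))
       + g y (X' z) (Y y) + g y (X y) (Y' z)" for z
    by (simp add: g_expand[OF y, of "X' z"] g_expand[OF y, of _ "Y' z"] sum.distrib distrib_left)
  ultimately show ?thesis by simp
qed

lemma Dg_expand:
  assumes y: "y \<in> S"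
  shows "Dg y z v w = (\<Sum>b\<in>Basis. \<Sum>b'\<in>Basis. (v \<bullet> b) * ((w \<bullet> b') * Dg y z b b'))"
  using has_derivative_unique[OF has_derivative_g[OF y]
      metric_product_rule_in_components[OF y has_derivative_const[of v] has_derivative_const[of w]]]
  by (simp add: fun_eq_iff bilinear_lzero[OF bil[OF y]] bilinear_rzero[OF bil[OF y]])

lemma metric_product_rule:
  assumes y: "y \<in> S" and X: "(X has_derivative X') (at y)" and Y: "(Y has_derivative Y') (at y)"
  shows "((\<lambda>p. g p (X p) (Y p)) has_derivative
    (\<lambda>z. Dg y z (X y) (Y y) + g y (X' z) (Y y) + g y (X y) (Y' z))) (at y)"
  using metric_product_rule_in_components[OF assms] by (simp add: Dg_expand[OF y, of _ "X y"])

lemma bilinear_Dg: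
  assumes y: "y \<in> S" shows "bilinear (Dg y z)"
proof -
  define B where "B v w = (\<Sum>b\<in>Basis. \<Sum>b'\<in>Basis. (v \<bullet> b) * ((w \<bullet> b') * Dg y z b b'))" for v w
  have "bilinear B"
    unfolding bilinear_def B_def
    by (auto intro!: linearI simp: inner_simps algebra_simps sum.distrib sum_distrib_left)
  moreover have "Dg y z = B" by (intro ext) (simp add: B_def Dg_expand[OF y, symmetric])
  ultimately show ?thesis by simp
qed

lemma Dg_sym:
  assumes y: "y \<in> S" shows "Dg y z v w = Dg y z w v"
proof -
  have "((\<lambda>p. g p w v) has_derivative (\<lambda>z. Dg y z v w)) (at y)"
    by (rule has_derivative_transform_within_open[OF has_derivative_g[OF y] open_S y]) (simp add: sym)
  from has_derivative_unique[OF this has_derivative_g[OF y]] show ?thesis by (simp add: fun_eq_iff)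
qed

text \<open>
  The musical isomorphism, that is, the inverse metric tensor \<open>g\<^sup>-\<^sup>1\<close>, where covectors are
  identified with vectors through the Euclidean inner product of the chart.
\<close>

definition sharp :: "'e \<Rightarrow> 'e \<Rightarrow> 'e" where
  "sharp y \<xi> = (THE z. \<forall>v. g y z v = \<xi> \<bullet> v)"

lemma g_sharp:
  assumes y: "y \<in> S" shows "g y (sharp y \<xi>) v = \<xi> \<bullet> v"
proof -
  have "linear (\<lambda>v. \<xi> \<bullet> v)" by (rule linearI) (auto simp: inner_simps)
  from theI'[OF inner_form_riesz[OF inner[OF y] this]] show ?thesis by (simp add: sharp_def)
qed

text \<open>
  Gradients and Christoffel symbols solve equations of this form. Solving them through the inverse
  metric transfers its regularity to them.
\<close>

lemma solution_eq_sum_sharp: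
  assumes y: "y \<in> S" and z: "\<And>v. g y z v = c v"
  shows "z = (\<Sum>b\<in>Basis. c b *\<^sub>R sharp y b)"
proof (rule inner_form_eqI[OF inner[OF y]])
  fix v
  show "g y z v = g y (\<Sum>b\<in>Basis. c b *\<^sub>R sharp y b) v"
    unfolding bilinear_sum_left[OF bil[OF y]] bilinear_expand_right[OF bil[OF y], of z v]
    by (simp add: g_sharp[OF y] z inner_commute mult.commute)
qed

lemma linear_sharp:
  assumes y: "y \<in> S" shows "linear (sharp y)"
  by (rule linearI; rule inner_form_eqI[OF inner[OF y]])
     (simp_all add: g_sharp y bilinear_ladd[OF bil] bilinear_lmul[OF bil] inner_simps)

lemma sharp_inner:
  assumes y: "y \<in> S" shows "sharp y \<xi> \<bullet> \<eta> = \<xi> \<bullet> sharp y \<eta>"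
  by (metis g_sharp[OF y] sym[OF y] inner_commute)

lemma sharp_pos:
  assumes y: "y \<in> S" and "\<xi> \<noteq> 0" shows "\<xi> \<bullet> sharp y \<xi> > 0"
proof -
  have "sharp y \<xi> \<noteq> 0" using g_sharp[OF y, of \<xi> \<xi>] assms(2) bilinear_lzero[OF bil[OF y]] by fastforce
  then have "g y (sharp y \<xi>) (sharp y \<xi>) > 0" using inner[OF y] by (simp add: inner_form_def)
  then show ?thesis by (simp add: g_sharp[OF y])
qed

text \<open>
  The resolvent identity \<open>P\<^sup>-\<^sup>1 = Y\<^sup>-\<^sup>1 - P\<^sup>-\<^sup>1 (P - Y) Y\<^sup>-\<^sup>1\<close> for the metrics at \<open>p\<close> and \<open>y\<close>.
  It yields regularity of the inverse metric without determinants: first a bound, then continuity,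
  then differentiability.
\<close>

lemma sharp_resolvent:
  assumes y: "y \<in> S" and p: "p \<in> S"
  shows "sharp p \<xi> = sharp y \<xi> - (\<Sum>b\<in>Basis. (g p (sharp y \<xi>) b - g y (sharp y \<xi>) b) *\<^sub>R sharp p b)"
proof -
  have "sharp y \<xi> = (\<Sum>b\<in>Basis. g p (sharp y \<xi>) b *\<^sub>R sharp p b)"
    by (rule solution_eq_sum_sharp[OF p]) simp
  moreover have "sharp p \<xi> = (\<Sum>b\<in>Basis. g y (sharp y \<xi>) b *\<^sub>R sharp p b)"
    by (rule solution_eq_sum_sharp[OF p]) (simp add: g_sharp y p)
  ultimately show ?thesis by (simp add: scaleR_diff_left sum_subtractf)
qed

lemma isCont_g: "y \<in> S \<Longrightarrow> isCont (\<lambda>p. g p v w) y"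
  using differentiable_g differentiable_imp_continuous_within by blast

text \<open>
  By the resolvent identity the total size \<open>s(p)\<close> of the inverse metric obeys
  \<open>s(p) \<le> s(y) + \<epsilon>(p) s(p)\<close> with \<open>\<epsilon>(p) \<longrightarrow> 0\<close>, so it stays bounded near \<open>y\<close>; inserting this bound
  into the identity again gives convergence.
\<close>

lemma isCont_sharp:
  assumes y: "y \<in> S" shows "isCont (\<lambda>p. sharp p \<xi>) y"
proof -
  define k where "k p b b' = g p (sharp y b) b' - g y (sharp y b) b'" for p b b'
  have k0: "((\<lambda>p. k p b b') \<longlongrightarrow> 0) (at y)" for b b'
    unfolding k_def using isCont_g[OF y] by (simp add: isCont_def LIM_zero)
  define \<epsilon> where "\<epsilon> p = (\<Sum>b\<in>Basis. \<Sum>b'\<in>Basis. \<bar>k p b b'\<bar>)" for p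
  have "(\<epsilon> \<longlongrightarrow> (\<Sum>b\<in>(Basis::'e set). \<Sum>b'\<in>(Basis::'e set). 0)) (at y)"
    unfolding \<epsilon>_def by (intro tendsto_sum tendsto_rabs_zero k0)
  then have "(\<epsilon> \<longlongrightarrow> 0) (at y)" by simp
  then have small: "\<forall>\<^sub>F p in at y. \<epsilon> p < 1 / 2" by (rule order_tendstoD) simp
  define s where "s p = (\<Sum>b\<in>Basis. norm (sharp p b))" for p
  have inS: "\<forall>\<^sub>F p in at y. p \<in> S" using open_S y by (rule eventually_at_in_open')
  have bound: "\<forall>\<^sub>F p in at y. s p \<le> 2 * s y"
    using small inS
  proof eventually_elim
    case (elim p)
    have "s p \<le> (\<Sum>b\<in>Basis. norm (sharp y b) + (\<Sum>b'\<in>Basis. \<bar>k p b b'\<bar> * norm (sharp p b')))"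
      unfolding s_def
    proof (rule sum_mono)
      fix b :: 'e assume "b \<in> Basis"
      have "norm (sharp p b) \<le> norm (sharp y b) + norm (\<Sum>b'\<in>Basis. k p b b' *\<^sub>R sharp p b')"
        unfolding k_def by (subst sharp_resolvent[OF y elim(2)]) (rule norm_triangle_ineq4)
      also have "norm (\<Sum>b'\<in>Basis. k p b b' *\<^sub>R sharp p b') \<le> (\<Sum>b'\<in>Basis. \<bar>k p b b'\<bar> * norm (sharp p b'))"
        using norm_sum[of "\<lambda>b'. k p b b' *\<^sub>R sharp p b'" Basis] by simp
      finally show "norm (sharp p b) \<le> norm (sharp y b) + (\<Sum>b'\<in>Basis. \<bar>k p b b'\<bar> * norm (sharp p b'))" by simp
    qed
    also have "\<dots> \<le> s y + (\<Sum>b\<in>Basis. \<Sum>b'\<in>Basis. \<bar>k p b b'\<bar> * s p)"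
      unfolding sum.distrib s_def
      by (intro add_mono order_refl sum_mono mult_left_mono member_le_sum) auto
    also have "\<dots> = s y + \<epsilon> p * s p" by (simp add: \<epsilon>_def sum_distrib_right)
    also have "\<dots> \<le> s y + 1 / 2 * s p"
      using elim(1) by (intro add_left_mono mult_right_mono) (auto simp: s_def intro: sum_nonneg)
    finally show ?case by simp
  qed
  have "((\<lambda>p. \<Sum>b'\<in>Basis. \<bar>g p (sharp y \<xi>) b' - g y (sharp y \<xi>) b'\<bar> * (2 * s y)) \<longlongrightarrow> (\<Sum>b'\<in>(Basis::'e set). 0 * (2 * s y))) (at y)"
    using isCont_g[OF y] by (intro tendsto_intros tendsto_rabs_zero) (simp add: isCont_def LIM_zero)
  then have lim: "((\<lambda>p. \<Sum>b'\<in>Basis. \<bar>g p (sharp y \<xi>) b' - g y (sharp y \<xi>) b'\<bar> * (2 * s y)) \<longlongrightarrow> 0) (at y)" by simp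
  have "((\<lambda>p. sharp p \<xi> - sharp y \<xi>) \<longlongrightarrow> 0) (at y)"
  proof (rule Lim_null_comparison[OF _ lim])
    show "\<forall>\<^sub>F p in at y. norm (sharp p \<xi> - sharp y \<xi>)
        \<le> (\<Sum>b'\<in>Basis. \<bar>g p (sharp y \<xi>) b' - g y (sharp y \<xi>) b'\<bar> * (2 * s y))"
      using bound inS
    proof eventually_elim
      case (elim p)
      have "norm (sharp p \<xi> - sharp y \<xi>) = norm (\<Sum>b\<in>Basis. (g p (sharp y \<xi>) b - g y (sharp y \<xi>) b) *\<^sub>R sharp p b)"
        by (subst sharp_resolvent[OF y elim(2)]) simp
      also have "\<dots> \<le> (\<Sum>b\<in>Basis. \<bar>g p (sharp y \<xi>) b - g y (sharp y \<xi>) b\<bar> * norm (sharp p b))"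
        using norm_sum[of "\<lambda>b. (g p (sharp y \<xi>) b - g y (sharp y \<xi>) b) *\<^sub>R sharp p b" Basis] by simp
      also have "\<dots> \<le> (\<Sum>b\<in>Basis. \<bar>g p (sharp y \<xi>) b - g y (sharp y \<xi>) b\<bar> * (2 * s y))"
      proof (intro sum_mono mult_left_mono)
        fix b :: 'e assume "b \<in> Basis"
        then have "norm (sharp p b) \<le> s p" unfolding s_def by (intro member_le_sum) auto
        then show "norm (sharp p b) \<le> 2 * s y" using elim(1) by simp
      qed simp
      finally show ?case .
    qed
  qed
  then show ?thesis unfolding isCont_def by (simp add: LIM_zero_iff)
qed

lemma continuous_sharp: "continuous_on S (\<lambda>p. sharp p \<xi>)"
  by (intro continuous_at_imp_continuous_on ballI isCont_sharp)

lemma differentiable_sharp: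
  assumes y: "y \<in> S" shows "(\<lambda>p. sharp p \<xi>) differentiable (at y)"
proof -
  have "((\<lambda>p. (g p (sharp y \<xi>) b - g y (sharp y \<xi>) b) *\<^sub>R sharp p b) has_derivative
      (\<lambda>h. Dg y h (sharp y \<xi>) b *\<^sub>R sharp y b)) (at y)" for b
    by (rule has_derivative_scaleR_vanishing[OF _ _ isCont_sharp[OF y]])
       (auto intro!: derivative_eq_intros has_derivative_g[OF y])
  then have "((\<lambda>p. sharp y \<xi> - (\<Sum>b\<in>Basis. (g p (sharp y \<xi>) b - g y (sharp y \<xi>) b) *\<^sub>R sharp p b)) has_derivative
      (\<lambda>h. 0 - (\<Sum>b\<in>Basis. Dg y h (sharp y \<xi>) b *\<^sub>R sharp y b))) (at y)"
    by (intro has_derivative_diff has_derivative_const has_derivative_sum)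
  then have "((\<lambda>p. sharp p \<xi>) has_derivative
      (\<lambda>h. 0 - (\<Sum>b\<in>Basis. Dg y h (sharp y \<xi>) b *\<^sub>R sharp y b))) (at y)"
    by (rule has_derivative_transform_within_open[OF _ open_S y]) (rule sharp_resolvent[OF y, symmetric])
  then show ?thesis unfolding differentiable_def by blast
qed

lemma g_gradient:
  assumes y: "y \<in> S" and f: "f differentiable (at y)"
  shows "g y (gradient g f y) v = frechet_derivative f (at y) v"
proof -
  have "linear (frechet_derivative f (at y))" using f by (rule linear_frechet_derivative)
  from theI'[OF inner_form_riesz[OF inner[OF y] this]] show ?thesis by (simp add: gradient_def)
qed

lemma g_christoffel:
  assumes y: "y \<in> S"
  shows "2 * g y (christoffel g y v w) x = Dg y v w x + Dg y w v x - Dg y x v w"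
proof -
  have 1: "linear (Dg y z v)" for z v
    using bilinear_Dg[OF y] by (simp add: bilinear_def)
  have "linear (\<lambda>x. (Dg y v w x + Dg y w v x - Dg y x v w) / 2)"
    by (rule linearI) (simp_all add: linear_add[OF 1] linear_cmul[OF 1] linear_add[OF linear_Dg[OF y]]
      linear_cmul[OF linear_Dg[OF y]] field_simps)
  from inner_form_riesz[OF inner[OF y] this]
  have "\<exists>!z. \<forall>x. 2 * g y z x = Dg y v w x + Dg y w v x - Dg y x v w"
    by (simp add: field_simps)
  from theI'[OF this] show ?thesis unfolding christoffel_def Dg_def by simp
qed

lemma bilinear_christoffel:
  assumes y: "y \<in> S" shows "bilinear (christoffel g y)"
proof -
  note lin = linear_add[OF linear_Dg[OF y]] linear_cmul[OF linear_Dg[OF y]]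
    bilinear_ladd[OF bilinear_Dg[OF y]] bilinear_radd[OF bilinear_Dg[OF y]]
    bilinear_lmul[OF bilinear_Dg[OF y]] bilinear_rmul[OF bilinear_Dg[OF y]]
    bilinear_ladd[OF bil[OF y]] bilinear_lmul[OF bil[OF y]]
  have eq: "z = z'" if "\<And>x. 2 * g y z x = 2 * g y z' x" for z z'
    by (rule inner_form_eqI[OF inner[OF y]]) (use that in simp)
  show ?thesis
    unfolding bilinear_def
  proof (intro conjI allI linearI; rule eq)
    fix v v' w x
    show "2 * g y (christoffel g y v (w + v')) x = 2 * g y (christoffel g y v w + christoffel g y v v') x"
      "2 * g y (christoffel g y (v + v') w) x = 2 * g y (christoffel g y v w + christoffel g y v' w) x"
      by (simp_all add: lin distrib_left g_christoffel[OF y])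
  next
    fix v w x and c :: real
    have "2 * g y (c *\<^sub>R christoffel g y v w) x = c * (Dg y v w x + Dg y w v x - Dg y x v w)"
      by (simp add: lin g_christoffel[OF y, symmetric])
    then show "2 * g y (christoffel g y v (c *\<^sub>R w)) x = 2 * g y (c *\<^sub>R christoffel g y v w) x"
      "2 * g y (christoffel g y (c *\<^sub>R v) w) x = 2 * g y (c *\<^sub>R christoffel g y v w) x"
      by (simp_all only: g_christoffel[OF y]) (simp_all add: lin algebra_simps)
  qed
qed

lemma continuous_christoffel: "continuous_on S (\<lambda>y. christoffel g y v w)"
proof -
  have "continuous_on S (\<lambda>y. \<Sum>b\<in>Basis. ((Dg y v w b + Dg y w v b - Dg y b v w) / 2) *\<^sub>R sharp y b)"
    unfolding Dg_def by (intro continuous_intros continuous_sharp continuous_Dg) simp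
  moreover have "christoffel g y v w = (\<Sum>b\<in>Basis. ((Dg y v w b + Dg y w v b - Dg y b v w) / 2) *\<^sub>R sharp y b)"
    if y: "y \<in> S" for y
    by (rule solution_eq_sum_sharp[OF y]) (simp add: g_christoffel[OF y, symmetric])
  ultimately show ?thesis by (simp cong: continuous_on_cong)
qed

text \<open>
  The Levi-Civita connection preserves the metric: the Koszul formulas for the two terms on the
  right add up to a single derivative of \<open>g\<close>.
\<close>

lemma metric_compatible:
  assumes y: "y \<in> S"
  shows "Dg y v a w = g y (christoffel g y v a) w + g y a (christoffel g y v w)"
  using g_christoffel[OF y, of v a w] g_christoffel[OF y, of v w a] sym[OF y, of a] Dg_sym[OF y]
  by (smt (verit))

definition Hess :: "('e \<Rightarrow> real) \<Rightarrow> 'e \<Rightarrow> 'e \<Rightarrow> 'e \<Rightarrow> real" where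
  "Hess f y v w = frechet_derivative (\<lambda>p. frechet_derivative f (at p) w) (at y) v
     - frechet_derivative f (at y) (christoffel g y v w)"

end

section \<open>The minimal graph equation as a linear elliptic equation\<close>

locale metric_chart_function = metric_chart +
  fixes f :: "'a \<Rightarrow> real"
  assumes f1: "y \<in> S \<Longrightarrow> f differentiable (at y)"
    and f2: "y \<in> S \<Longrightarrow> (\<lambda>p. frechet_derivative f (at p) w) differentiable (at y)"
begin

abbreviation "f' y \<equiv> frechet_derivative f (at y)"
abbreviation "f'' y v w \<equiv> frechet_derivative (\<lambda>p. frechet_derivative f (at p) w) (at y) v"
abbreviation "G \<equiv> gradient g f"

lemma has_derivative_f: "y \<in> S \<Longrightarrow> (f has_derivative f' y) (at y)"
  using f1 by (simp add: frechet_derivative_works)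

lemma has_derivative_f':
  "y \<in> S \<Longrightarrow> ((\<lambda>p. f' p w) has_derivative (\<lambda>v. f'' y v w)) (at y)"
  using f2 by (simp add: frechet_derivative_works eta_contract_eq)

lemma linear_f': "y \<in> S \<Longrightarrow> linear (f' y)"
  using f1 by (rule linear_frechet_derivative)

lemma g_G: "y \<in> S \<Longrightarrow> g y (G y) v = f' y v"
  using g_gradient f1 by blast

lemma bilinear_f'':
  assumes y: "y \<in> S" shows "bilinear (f'' y)"
proof -
  have "f'' y v (w + w') = f'' y v w + f'' y v w'" for v w w'
  proof -
    have "((\<lambda>p. f' p w + f' p w') has_derivative (\<lambda>v. f'' y v w + f'' y v w')) (at y)"
      by (intro has_derivative_add has_derivative_f' y)
    then have "((\<lambda>p. f' p (w + w')) has_derivative (\<lambda>v. f'' y v w + f'' y v w')) (at y)"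
      by (rule has_derivative_transform_within_open[OF _ open_S y]) (simp add: linear_add[OF linear_f'])
    from has_derivative_unique[OF has_derivative_f'[OF y] this] show ?thesis by (simp add: fun_eq_iff)
  qed
  moreover have "f'' y v (c *\<^sub>R w) = c *\<^sub>R f'' y v w" for v w c
  proof -
    have "((\<lambda>p. c *\<^sub>R f' p w) has_derivative (\<lambda>v. c *\<^sub>R f'' y v w)) (at y)"
      by (intro has_derivative_scaleR_right has_derivative_f' y)
    then have "((\<lambda>p. f' p (c *\<^sub>R w)) has_derivative (\<lambda>v. c *\<^sub>R f'' y v w)) (at y)"
      by (rule has_derivative_transform_within_open[OF _ open_S y]) (simp add: linear_cmul[OF linear_f'])
    from has_derivative_unique[OF has_derivative_f'[OF y] this] show ?thesis by (simp add: fun_eq_iff)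
  qed
  ultimately show ?thesis
    unfolding bilinear_def using has_derivative_linear[OF has_derivative_f'[OF y]]
    by (auto intro!: linearI)
qed

lemma bilinear_Hess:
  assumes y: "y \<in> S" shows "bilinear (Hess f y)"
  using bilinear_f''[OF y] bilinear_christoffel[OF y] linear_f'[OF y]
  unfolding Hess_def bilinear_def
  by (auto intro!: linear_compose_sub linear_compose[of _ "f' y", unfolded o_def])

lemma G_eq: "y \<in> S \<Longrightarrow> G y = (\<Sum>b\<in>Basis. f' y b *\<^sub>R sharp y b)"
  by (rule solution_eq_sum_sharp) (auto simp: g_G)

lemma differentiable_G:
  assumes y: "y \<in> S" shows "G differentiable (at y)"
proof -
  have "(\<lambda>p. \<Sum>b\<in>Basis. f' p b *\<^sub>R sharp p b) differentiable (at y)"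
    by (intro differentiable_sum ballI differentiable_scaleR f2 differentiable_sharp y finite_Basis)
  then obtain D where "((\<lambda>p. \<Sum>b\<in>Basis. f' p b *\<^sub>R sharp p b) has_derivative D) (at y)"
    unfolding differentiable_def by blast
  then have "(G has_derivative D) (at y)"
    by (rule has_derivative_transform_within_open[OF _ open_S y]) (simp add: G_eq)
  then show ?thesis unfolding differentiable_def by blast
qed

lemma continuous_G: "continuous_on S G"
  using differentiable_G by (meson continuous_at_imp_continuous_on differentiable_imp_continuous_within)

lemma has_derivative_G: "y \<in> S \<Longrightarrow> (G has_derivative frechet_derivative G (at y)) (at y)"
  using differentiable_G by (simp add: frechet_derivative_works)

text \<open>
  Differentiate \<open>g(grad f, w) = df(w)\<close> and use that the connection is metric.
\<close>

lemma covariant_deriv_gradient: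
  assumes y: "y \<in> S"
  shows "g y (covariant_deriv g (\<lambda>_. v) G y) w = Hess f y v w"
proof -
  define D where "D = frechet_derivative G (at y)"
  have "((\<lambda>p. g p (G p) w) has_derivative (\<lambda>z. Dg y z (G y) w + g y (D z) w + g y (G y) 0)) (at y)"
    unfolding D_def by (intro metric_product_rule y has_derivative_G has_derivative_const)
  then have "((\<lambda>p. f' p w) has_derivative (\<lambda>z. Dg y z (G y) w + g y (D z) w + g y (G y) 0)) (at y)"
    by (rule has_derivative_transform_within_open[OF _ open_S y]) (simp add: g_G)
  from has_derivative_unique[OF has_derivative_f'[OF y] this]
  have "f'' y v w = Dg y v (G y) w + g y (D v) w + g y (G y) 0" by (simp add: fun_eq_iff)
  then show ?thesis
    by (simp add: covariant_deriv_def Hess_def D_def metric_compatible[OF y] g_G[OF y]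
      bilinear_ladd[OF bil[OF y]] linear_0[OF linear_f'[OF y]])
qed

abbreviation "N y \<equiv> g y (G y) (G y)"

lemma N_nonneg: "y \<in> S \<Longrightarrow> N y \<ge> 0"
  using inner inner_form_nonneg by blast

lemma has_derivative_N:
  assumes y: "y \<in> S" shows "(N has_derivative (\<lambda>v. 2 * Hess f y v (G y))) (at y)"
proof -
  define D where "D = frechet_derivative G (at y)"
  have "(N has_derivative (\<lambda>z. Dg y z (G y) (G y) + g y (D z) (G y) + g y (G y) (D z))) (at y)"
    unfolding D_def by (intro metric_product_rule y has_derivative_G)
  moreover have "Dg y z (G y) (G y) + g y (D z) (G y) + g y (G y) (D z) = 2 * Hess f y z (G y)" for z
    unfolding covariant_deriv_gradient[OF y, symmetric] covariant_deriv_def D_def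
    by (simp add: metric_compatible[OF y] bilinear_ladd[OF bil[OF y]] sym[OF y, of "G y"])
  ultimately show ?thesis by simp
qed

text \<open>
  With \<open>\<psi> = (1 + |grad f|\<^sup>2)\<^sup>-\<^sup>1\<^sup>/\<^sup>2\<close> one has \<open>div (\<psi> grad f) = \<psi> tr Hess f + d\<psi>(grad f)\<close>, and
  \<open>d\<psi> = - \<psi>\<^sup>3 Hess f(\<cdot>, grad f)\<close> by the previous lemma.
\<close>

lemma divergence_minimal_graph:
  assumes y: "y \<in> S"
  shows "divergence g (\<lambda>p. (1 / sqrt (1 + (vec_length g p (G p))\<^sup>2)) *\<^sub>R G p) y =
    (1 / sqrt (1 + N y)) * ((\<Sum>b\<in>Basis. Hess f y b (sharp y b)) - Hess f y (G y) (G y) / (1 + N y))"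
proof -
  define \<psi> where "\<psi> p = 1 / sqrt (1 + (vec_length g p (G p))\<^sup>2)" for p
  define \<psi>' where "\<psi>' v = - (\<psi> y / (1 + N y)) * Hess f y v (G y)" for v
  have pos: "1 + N y > 0" using N_nonneg[OF y] by simp
  have len: "(vec_length g p (G p))\<^sup>2 = N p" if "p \<in> S" for p
    using N_nonneg[OF that] by (simp add: vec_length_def)
  have "((\<lambda>p. 1 / sqrt (1 + N p)) has_derivative \<psi>') (at y)"
    using pos by (auto intro!: derivative_eq_intros has_derivative_N[OF y] ext
      simp: \<psi>'_def \<psi>_def len[OF y] field_simps)
  then have \<psi>: "(\<psi> has_derivative \<psi>') (at y)"
    by (rule has_derivative_transform_within_open[OF _ open_S y]) (simp add: \<psi>_def len)
  have "((\<lambda>p. \<psi> p *\<^sub>R G p) has_derivative (\<lambda>v. \<psi> y *\<^sub>R frechet_derivative G (at y) v + \<psi>' v *\<^sub>R G y)) (at y)"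
    by (intro has_derivative_scaleR \<psi> has_derivative_G y)
  then have fd: "frechet_derivative (\<lambda>p. \<psi> p *\<^sub>R G p) (at y) =
      (\<lambda>v. \<psi> y *\<^sub>R frechet_derivative G (at y) v + \<psi>' v *\<^sub>R G y)"
    by (rule frechet_derivative_at[symmetric])
  have cov: "covariant_deriv g (\<lambda>_. v) (\<lambda>p. \<psi> p *\<^sub>R G p) y =
      \<psi> y *\<^sub>R covariant_deriv g (\<lambda>_. v) G y + \<psi>' v *\<^sub>R G y" for v
    unfolding covariant_deriv_def fd
    by (simp add: bilinear_rmul[OF bilinear_christoffel[OF y]] scaleR_add_right)
  have tr: "covariant_deriv g (\<lambda>_. b) G y \<bullet> b = Hess f y b (sharp y b)" for b
    using g_sharp[OF y, of b "covariant_deriv g (\<lambda>_. b) G y"] covariant_deriv_gradient[OF y, of b "sharp y b"]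
      sym[OF y] by (simp add: inner_commute)
  have "(\<Sum>b\<in>Basis. \<psi>' b * (G y \<bullet> b)) = \<psi>' (G y)"
    unfolding \<psi>'_def by (simp add: bilinear_expand_left[OF bilinear_Hess[OF y], of "G y" "G y"]
      sum_distrib_left sum_divide_distrib mult_ac sum_negf)
  then have "divergence g (\<lambda>p. \<psi> p *\<^sub>R G p) y = \<psi> y * (\<Sum>b\<in>Basis. Hess f y b (sharp y b)) + \<psi>' (G y)"
    unfolding divergence_def cov by (simp add: inner_add_left tr sum.distrib sum_distrib_left)
  then show ?thesis unfolding \<psi>_def \<psi>'_def len[OF y] by (simp add: right_diff_distrib)
qed

text \<open>
  The principal coefficients of the minimal graph equation after multiplication by
  \<open>(1 + |grad f|\<^sup>2)\<^sup>3\<^sup>/\<^sup>2\<close>. They are frozen at the given function \<open>f\<close>, so that the equation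
  becomes linear in the Hessian.
\<close>

definition coeff where "coeff y \<xi> = (1 + N y) *\<^sub>R sharp y \<xi> - (G y \<bullet> \<xi>) *\<^sub>R G y"

lemma trace_coeff:
  assumes y: "y \<in> S"
    and eq: "divergence g (\<lambda>p. (1 / sqrt (1 + (vec_length g p (G p))\<^sup>2)) *\<^sub>R G p) y = 0"
  shows "(\<Sum>b\<in>Basis. Hess f y b (coeff y b)) = 0"
proof -
  note b = bilinear_Hess[OF y]
  have pos: "1 + N y > 0" using N_nonneg[OF y] by simp
  then have *: "(1 + N y) * (\<Sum>b\<in>Basis. Hess f y b (sharp y b)) = Hess f y (G y) (G y)"
    using eq unfolding divergence_minimal_graph[OF y]
    by (simp add: eq_divide_eq mult.commute)
  show ?thesis
    unfolding coeff_def
    by (simp add: bilinear_rsub[OF b] bilinear_rmul[OF b] sum_subtractf *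
      bilinear_expand_left[OF b, of "G y" "G y"] flip: sum_distrib_left)
qed

lemma linear_coeff: "y \<in> S \<Longrightarrow> linear (coeff y)"
  unfolding coeff_def by (rule linearI)
   (simp_all add: linear_add[OF linear_sharp] linear_cmul[OF linear_sharp] inner_simps algebra_simps)

lemma coeff_sym: "y \<in> S \<Longrightarrow> coeff y v \<bullet> w = v \<bullet> coeff y w"
  unfolding coeff_def using sharp_inner[of y v w] by (simp add: inner_simps inner_commute)

text \<open>
  By Cauchy--Schwarz \<open>(grad f \<bullet> \<xi>)\<^sup>2 \<le> g\<^sup>-\<^sup>1(\<xi>, \<xi>) |grad f|\<^sup>2\<close>, so the negative term is absorbed and
  at least \<open>g\<^sup>-\<^sup>1(\<xi>, \<xi>)\<close> remains.
\<close>

lemma coeff_pos: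
  assumes y: "y \<in> S" and "\<xi> \<noteq> 0" shows "\<xi> \<bullet> coeff y \<xi> > 0"
proof -
  have "(G y \<bullet> \<xi>)\<^sup>2 = (g y (sharp y \<xi>) (G y))\<^sup>2" by (simp add: g_sharp[OF y] inner_commute)
  also have "\<dots> \<le> (\<xi> \<bullet> sharp y \<xi>) * N y"
    using inner_form_Cauchy_Schwarz[OF inner[OF y], of "sharp y \<xi>" "G y"] by (simp add: g_sharp[OF y])
  finally show ?thesis using sharp_pos[OF assms]
    by (simp add: coeff_def inner_simps power2_eq_square algebra_simps inner_commute)
qed

lemma continuous_N: "continuous_on S N"
  using has_derivative_N by (meson continuous_at_imp_continuous_on has_derivative_continuous)

lemma continuous_coeff: "continuous_on S (\<lambda>y. coeff y \<xi>)"
  unfolding coeff_def by (intro continuous_intros continuous_N continuous_sharp continuous_G)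

lemma continuous_christoffel_coeff: "continuous_on S (\<lambda>y. \<Sum>b\<in>Basis. christoffel g y b (coeff y b))"
proof -
  have "continuous_on S (\<lambda>y. \<Sum>b\<in>Basis. \<Sum>b'\<in>Basis. (coeff y b \<bullet> b') *\<^sub>R christoffel g y b b')"
    by (intro continuous_intros continuous_coeff continuous_christoffel)
  moreover have "christoffel g y b (coeff y b) = (\<Sum>b'\<in>Basis. (coeff y b \<bullet> b') *\<^sub>R christoffel g y b b')"
    if "y \<in> S" for y b
  proof -
    have "linear (christoffel g y b)" using bilinear_christoffel[OF that] by (simp add: bilinear_def)
    from linear_sum[OF this, of "\<lambda>b'. (coeff y b \<bullet> b') *\<^sub>R b'" Basis] linear_cmul[OF this]
    show ?thesis by (simp add: euclidean_representation)
  qed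
  ultimately show ?thesis by (simp cong: continuous_on_cong)
qed

end

section \<open>Charts of the cylinder\<close>

lemma Ck_on_cong:
  assumes "open S" "\<And>x. x \<in> S \<Longrightarrow> f x = h x"
  shows "Ck_on k S f \<longleftrightarrow> Ck_on k S h"
  using assms(2)
proof (induction k arbitrary: f h)
  case 0
  then show ?case by (auto cong: continuous_on_cong)
next
  case (Suc k)
  have der: "(f has_derivative D) (at x) \<longleftrightarrow> (h has_derivative D) (at x)" if "x \<in> S" for x D
    using has_derivative_transform_within_open[OF _ assms(1) that] Suc.prems by metis
  then have "frechet_derivative f (at x) = frechet_derivative h (at x)" if "x \<in> S" for x
    using that by (simp add: frechet_derivative_def)
  then have "Ck_on k S (\<lambda>x. frechet_derivative f (at x) v) \<longleftrightarrow> Ck_on k S (\<lambda>x. frechet_derivative h (at x) v)" for v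
    by (intro Suc.IH) simp
  then show ?case using der by (simp add: differentiable_def)
qed

lemma Cinf_on_const: "Cinf_on S (\<lambda>_. c)"
proof -
  have "Ck_on k S (\<lambda>_. c)" for k
    by (induction k arbitrary: c) (auto simp: frechet_derivative_const)
  then show ?thesis by (simp add: Cinf_on_def)
qed

lemma Cinf_on_affine:
  assumes "bounded_linear f" shows "Cinf_on S (\<lambda>x. f x + c)"
proof -
  have d: "((\<lambda>x. f x + c) has_derivative f) (at x)" for x
    using has_derivative_add[OF bounded_linear_imp_has_derivative[OF assms] has_derivative_const] by simp
  then have fd: "frechet_derivative (\<lambda>x. f x + c) (at x) = f" for x
    by (rule frechet_derivative_at[symmetric])
  have "Ck_on (Suc k) S (\<lambda>x. f x + c)" for k
    using d Cinf_on_const unfolding Cinf_on_def by (auto simp: fd differentiable_def)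
  moreover have "Ck_on 0 S (\<lambda>x. f x + c)"
    using d by (auto intro!: continuous_at_imp_continuous_on has_derivative_continuous)
  ultimately show ?thesis unfolding Cinf_on_def by (metis not0_implies_Suc)
qed

lemma Cinf_onD:
  assumes "Cinf_on S f"
  shows "continuous_on S f"
    and "x \<in> S \<Longrightarrow> f differentiable (at x)"
    and "continuous_on S (\<lambda>x. frechet_derivative f (at x) v)"
    and "x \<in> S \<Longrightarrow> (\<lambda>x. frechet_derivative f (at x) v) differentiable (at x)"
proof -
  have "Ck_on 0 S f" "Ck_on (Suc 0) S f" "Ck_on (Suc (Suc 0)) S f"
    using assms unfolding Cinf_on_def by blast+
  then show "continuous_on S f" "x \<in> S \<Longrightarrow> f differentiable (at x)"
    "continuous_on S (\<lambda>x. frechet_derivative f (at x) v)"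
    "x \<in> S \<Longrightarrow> (\<lambda>x. frechet_derivative f (at x) v) differentiable (at x)" by auto
qed

abbreviation cyl :: "('i, 'a, 'e::euclidean_space) riem_data \<Rightarrow> (unit \<times> 'i, real \<times> 'a, real \<times> 'e) riem_data" where
  "cyl F \<equiv> riem_prod riem_line F"

lemma charts_cyl: "charts (cyl F) = UNIV \<times> charts F"
  by (simp add: riem_prod_def riem_line_def)

lemma chart_img_cyl: "chart_img (cyl F) (i, j) = UNIV \<times> chart_img F j"
  by (auto simp: chart_img_def riem_prod_def riem_line_def image_iff)

lemma metric_cyl: "metric (cyl F) (i, j) p v w = fst v * fst w + metric F j (snd p) (snd v) (snd w)"
  by (simp add: riem_prod_def riem_line_def split_beta)

locale cylinder_chart =
  fixes F :: "('i, 'a, 'e::euclidean_space) riem_data" and j :: 'i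
  assumes smooth: "smooth_manifold F" and riem: "riemannian_metric F" and j_chart: "j \<in> charts F"
begin

abbreviation S :: "(real \<times> 'e) set" where "S \<equiv> UNIV \<times> chart_img F j"
abbreviation "g \<equiv> metric (cyl F) ((), j)"

lemma inj_chart: "inj_on (chart F j) (chart_dom F j)"
proof -
  have "homeomorphic_map (subtopology (mtop F) (chart_dom F j)) (top_of_set (chart_img F j)) (chart F j)"
    "openin (mtop F) (chart_dom F j)"
    using smooth j_chart by (auto simp: smooth_manifold_def)
  then show ?thesis
    by (metis homeomorphic_imp_injective_map inf.absorb_iff2 openin_subset topspace_subtopology)
qed

lemma chart_inv_cyl:
  "y \<in> chart_img F j \<Longrightarrow> chart_inv (cyl F) ((), j) (s, y) = (s, chart_inv F j y)"
  using inj_chart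
  by (auto simp: chart_img_def chart_inv_def riem_prod_def riem_line_def
      intro!: inv_into_f_eq inj_onI dest: inj_onD)

lemma chart_inv_chart: "x \<in> chart_dom F j \<Longrightarrow> chart_inv F j (chart F j x) = x"
  by (simp add: chart_inv_def inj_chart)

lemma chart_inv_in_dom: "y \<in> chart_img F j \<Longrightarrow> chart_inv F j y \<in> chart_dom F j"
  by (simp add: chart_img_def chart_inv_def inv_into_into)

lemma open_chart_img: "open (chart_img F j)"
  using smooth j_chart by (auto simp: smooth_manifold_def)

lemma inner_form_F: "y \<in> chart_img F j \<Longrightarrow> inner_form (metric F j y)"
  using riem j_chart by (simp add: riemannian_metric_def inner_form_def)

lemma smooth_metric: "Cinf_on (chart_img F j) (\<lambda>y. metric F j y v w)"
  using riem j_chart by (simp add: riemannian_metric_def)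

lemma has_derivative_metric_cyl:
  assumes "p \<in> S"
  shows "((\<lambda>p. g p v w) has_derivative
    (\<lambda>z. frechet_derivative (\<lambda>q. metric F j q (snd v) (snd w)) (at (snd p)) (snd z))) (at p)"
proof -
  have "((\<lambda>q. metric F j q (snd v) (snd w)) has_derivative
      frechet_derivative (\<lambda>q. metric F j q (snd v) (snd w)) (at (snd p))) (at (snd p))"
    using Cinf_onD(2)[OF smooth_metric] assms by (auto simp: frechet_derivative_works)
  from has_derivative_compose[OF has_derivative_snd[OF has_derivative_ident] this]
  have "((\<lambda>p. fst v * fst w + metric F j (snd p) (snd v) (snd w)) has_derivative
    (\<lambda>z. 0 + frechet_derivative (\<lambda>q. metric F j q (snd v) (snd w)) (at (snd p)) (snd z))) (at p)"
    by (intro has_derivative_add has_derivative_const)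
  then show ?thesis by (simp add: metric_cyl)
qed

lemma frechet_metric_cyl:
  "p \<in> S \<Longrightarrow> frechet_derivative (\<lambda>p. g p v w) (at p) z =
    frechet_derivative (\<lambda>q. metric F j q (snd v) (snd w)) (at (snd p)) (snd z)"
  using frechet_derivative_at[OF has_derivative_metric_cyl] by metis

sublocale metric_chart S g
proof
  show "open S" by (intro open_Times open_chart_img open_UNIV)
next
  fix y :: "real \<times> 'e" assume "y \<in> S"
  then have F: "inner_form (metric F j (snd y))" by (auto intro: inner_form_F)
  then have b: "bilinear (metric F j (snd y))" and s: "metric F j (snd y) v w = metric F j (snd y) w v" for v w
    by (auto simp: inner_form_def)
  show "inner_form (g y)"
    unfolding inner_form_def
  proof (intro conjI allI impI)
    show "bilinear (g y)"
      unfolding bilinear_def metric_cyl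
      by (auto intro!: linearI simp: bilinear_ladd[OF b] bilinear_radd[OF b] bilinear_lmul[OF b]
        bilinear_rmul[OF b] algebra_simps)
    show "g y v w = g y w v" for v w by (simp add: metric_cyl s[of "snd v"])
  next
    fix v :: "real \<times> 'e" assume "v \<noteq> 0"
    then have "fst v \<noteq> 0 \<or> snd v \<noteq> 0" by (simp add: prod_eq_iff)
    then show "g y v v > 0"
    proof
      assume "fst v \<noteq> 0"
      then have "fst v * fst v > 0" by (metis mult_neg_neg mult_pos_pos linorder_neqE_linordered_idom)
      then show ?thesis unfolding metric_cyl using inner_form_nonneg[OF F, of "snd v"] by linarith
    next
      assume "snd v \<noteq> 0"
      then have "metric F j (snd y) (snd v) (snd v) > 0" using F by (simp add: inner_form_def)
      then show ?thesis unfolding metric_cyl using zero_le_square[of "fst v"] by linarith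
    qed
  qed
  show "(\<lambda>p. g p v w) differentiable at y" for v w
    using has_derivative_metric_cyl[OF \<open>y \<in> S\<close>] unfolding differentiable_def by blast
next
  fix v w z :: "real \<times> 'e"
  have "continuous_on (snd ` S) (\<lambda>q. frechet_derivative (\<lambda>q. metric F j q (snd v) (snd w)) (at q) (snd z))"
    using Cinf_onD(3)[OF smooth_metric] by (rule continuous_on_subset) auto
  then have "continuous_on S (\<lambda>p. frechet_derivative (\<lambda>q. metric F j q (snd v) (snd w)) (at (snd p)) (snd z))"
    by (rule continuous_on_compose2[OF _ continuous_on_snd[OF continuous_on_id]]) simp
  then show "continuous_on S (\<lambda>y. frechet_derivative (\<lambda>p. g p v w) (at y) z)"
    by (simp cong: continuous_on_cong add: frechet_metric_cyl)
qed

text \<open>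
  The coordinate \<open>s\<close> of the line has vanishing Hessian: for the parallel field \<open>\<partial>\<^sub>s\<close>, Koszul's formula
  contains only derivatives of the constant \<open>g(\<cdot>, \<partial>\<^sub>s)\<close> and a derivative of \<open>g\<close> in direction \<open>\<partial>\<^sub>s\<close>.
\<close>

lemma fst_christoffel:
  assumes y: "y \<in> S" shows "fst (christoffel g y v w) = 0"
proof -
  have const: "Dg y z v (1, 0) = 0" for z v
  proof -
    have "((\<lambda>p. g p v (1, 0)) has_derivative (\<lambda>z. 0)) (at y)"
    proof (rule has_derivative_transform_within_open[OF has_derivative_const open_S y])
      fix p assume "p \<in> S"
      then have "bilinear (metric F j (snd p))" using inner_form_F by (auto simp: inner_form_def)
      then show "fst v = g p v (1, 0)" by (simp add: metric_cyl bilinear_rzero)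
    qed
    from has_derivative_unique[OF this has_derivative_g[OF y]] show ?thesis by metis
  qed
  have "Dg y (1, 0) v w = 0"
    unfolding Dg_def frechet_metric_cyl[OF y]
    using Cinf_onD(2)[OF smooth_metric] y by (auto intro!: linear_0 linear_frechet_derivative)
  then have "g y (christoffel g y v w) (1, 0) = 0"
    using g_christoffel[OF y, of v w "(1, 0)"] const by simp
  moreover have "bilinear (metric F j (snd y))" using y inner_form_F by (auto simp: inner_form_def)
  ultimately show ?thesis by (simp add: metric_cyl bilinear_rzero)
qed

end

locale cylinder_chart_function = cylinder_chart +
  fixes u :: "real \<times> 'b \<Rightarrow> real"
  assumes smooth_u: "Cinf_on (UNIV \<times> chart_img F j) (u \<circ> chart_inv (cyl F) ((), j))"
begin

abbreviation "h \<equiv> u \<circ> chart_inv (cyl F) ((), j)"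

sublocale metric_chart_function S g h
  using Cinf_onD(2,4)[OF smooth_u] by unfold_locales

lemma grad_cyl: "grad (cyl F) u ((), j) = G"
  by (simp add: grad_def)

lemma grad_length_cyl: "grad_length (cyl F) u ((), j) y = sqrt (N y)"
  by (simp add: grad_length_def vec_length_def grad_def)

lemma divergence_cyl:
  assumes y: "y \<in> S"
  shows "divergence g (\<lambda>p. (1 / sqrt (1 + (grad_length (cyl F) u ((), j) p)\<^sup>2)) *\<^sub>R grad (cyl F) u ((), j) p) y =
    (1 / sqrt (1 + N y)) * ((\<Sum>b\<in>Basis. Hess h y b (sharp y b)) - Hess h y (G y) (G y) / (1 + N y))"
  unfolding divergence_minimal_graph[OF y, symmetric] by (simp add: grad_length_def grad_cyl)

text \<open>
  If \<open>u\<close> solves the minimal graph equation, then \<open>c u + k s\<close> solves a linear elliptic equation without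
  zeroth-order term for all \<open>c\<close> and \<open>k\<close>: the coefficients are frozen at \<open>u\<close>, and \<open>s\<close> has
  vanishing Hessian. With \<open>c = -1\<close> the lemma is the minimum principle.
\<close>

lemma strong_maximum_principle_chart:
  assumes eq: "\<And>y. y \<in> S \<Longrightarrow> divergence g
      (\<lambda>p. (1 / sqrt (1 + (grad_length (cyl F) u ((), j) p)\<^sup>2)) *\<^sub>R grad (cyl F) u ((), j) p) y = 0"
    and T: "open T" "T \<subseteq> S" "p \<in> T"
    and max: "\<And>y. y \<in> T \<Longrightarrow> c * h y + k * fst y \<le> m" "c * h p + k * fst p = m"
  shows "\<exists>r>0. ball p r \<subseteq> T \<and> (\<forall>y\<in>ball p r. c * h y + k * fst y = m)"
proof (rule Hopf_strong_maximum_principle[where a = coeff and B = "\<lambda>y. - (\<Sum>b\<in>Basis. christoffel g y b (coeff y b))"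
      and D = "\<lambda>y v. c * f' y v + k * fst v" and H = "\<lambda>y v w. c * f'' y v w", OF T(1,3)])
  fix y assume "y \<in> T"
  then have y: "y \<in> S" using T by auto
  show "((\<lambda>y. c * h y + k * fst y) has_derivative (\<lambda>v. c * f' y v + k * fst v)) (at y)"
    using has_derivative_f[OF y] unfolding o_def by (auto intro!: derivative_eq_intros)
  show "((\<lambda>y. c * f' y v + k * fst v) has_derivative (\<lambda>w. c * f'' y w v)) (at y)" for v
    using has_derivative_f'[OF y, of v] by (auto intro!: derivative_eq_intros)
  show "bilinear (\<lambda>v w. c * f'' y v w)"
    using bilinear_f''[OF y] unfolding bilinear_def by (auto simp: linear_iff algebra_simps)
  show "linear (coeff y)" "\<And>v w. coeff y v \<bullet> w = v \<bullet> coeff y w" "\<And>v. v \<noteq> 0 \<Longrightarrow> v \<bullet> coeff y v > 0"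
    using linear_coeff[OF y] coeff_sym[OF y] coeff_pos[OF y] by auto
  define B where "B = (\<Sum>b\<in>Basis. christoffel g y b (coeff y b))"
  have "fst B = 0" unfolding B_def fst_sum by (simp add: fst_christoffel[OF y])
  have "0 = (\<Sum>b\<in>Basis. Hess h y b (coeff y b))"
    using eq[OF y] by (intro trace_coeff[OF y, symmetric]) (simp add: grad_length_def grad_cyl)
  also have "\<dots> = (\<Sum>b\<in>Basis. f'' y b (coeff y b)) - f' y B"
    by (simp add: Hess_def sum_subtractf B_def linear_sum[OF linear_f'[OF y]])
  finally have "c * ((\<Sum>b\<in>Basis. f'' y b (coeff y b)) - f' y B) = 0" by simp
  then have "(\<Sum>b\<in>Basis. c * f'' y b (coeff y b)) + (c * f' y (- B) + k * fst (- B)) = 0"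
    using \<open>fst B = 0\<close> by (simp add: linear_neg[OF linear_f'[OF y]] sum_distrib_left algebra_simps)
  then show "(\<Sum>b\<in>Basis. c * f'' y b (coeff y b)) + (c * f' y (- (\<Sum>b\<in>Basis. christoffel g y b (coeff y b)))
      + k * fst (- (\<Sum>b\<in>Basis. christoffel g y b (coeff y b)))) = 0"
    by (simp add: B_def)
next
  show "continuous_on T (\<lambda>y. coeff y v)" for v
    using continuous_coeff T(2) by (rule continuous_on_subset)
  show "continuous_on T (\<lambda>y. - (\<Sum>b\<in>Basis. christoffel g y b (coeff y b)))"
    using continuous_christoffel_coeff T(2) by (intro continuous_on_minus) (rule continuous_on_subset)
qed (use max in auto)

lemma affine_solution:
  assumes aff: "\<And>p. p \<in> S \<Longrightarrow> h p = k * fst p + d" and y: "y \<in> S"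
  shows "grad_length (cyl F) u ((), j) y = \<bar>k\<bar>"
    and "divergence g (\<lambda>p. (1 / sqrt (1 + (grad_length (cyl F) u ((), j) p)\<^sup>2)) *\<^sub>R grad (cyl F) u ((), j) p) y = 0"
proof -
  have f': "f' p v = k * fst v" if p: "p \<in> S" for p v
  proof -
    have "((\<lambda>p. k * fst p + d) has_derivative (\<lambda>v. k * fst v)) (at p)"
      by (auto intro!: derivative_eq_intros)
    then have "(h has_derivative (\<lambda>v. k * fst v)) (at p)"
      by (rule has_derivative_transform_within_open[OF _ open_S p]) (use aff in simp)
    from frechet_derivative_at[OF this] show ?thesis by metis
  qed
  have "f'' y v w = 0" for v w
  proof -
    have "((\<lambda>p. f' p w) has_derivative (\<lambda>v. 0)) (at y)"
      by (rule has_derivative_transform_within_open[OF has_derivative_const[of "k * fst w"] open_S y]) (simp add: f')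
    from frechet_derivative_at[OF this] show ?thesis by metis
  qed
  then have "Hess h y v w = 0" for v w
    by (simp add: Hess_def f'[OF y] fst_christoffel[OF y])
  then show "divergence g (\<lambda>p. (1 / sqrt (1 + (grad_length (cyl F) u ((), j) p)\<^sup>2)) *\<^sub>R grad (cyl F) u ((), j) p) y = 0"
    unfolding divergence_cyl[OF y] by simp
  have "bilinear (metric F j (snd y))" using y inner_form_F by (auto simp: inner_form_def)
  then have "fst (G y) = g y (G y) (1, 0)" by (simp add: metric_cyl bilinear_rzero)
  also have "\<dots> = k" by (simp add: g_G[OF y] f'[OF y])
  finally have "N y = k * k" by (simp add: g_G[OF y] f'[OF y])
  then show "grad_length (cyl F) u ((), j) y = \<bar>k\<bar>" by (simp add: grad_length_cyl)
qed

end

section \<open>Locally constant predicates and convex functions on the line\<close>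

lemma connectedin_locally_constant:
  assumes C: "connectedin X C"
    and loc: "\<And>z. z \<in> C \<Longrightarrow> \<exists>U. openin X U \<and> z \<in> U \<and> (\<forall>y\<in>U. P y \<longleftrightarrow> P z)"
    and "x \<in> C" "y \<in> C" "P x"
  shows "P y"
proof (rule ccontr)
  assume "\<not> P y"
  define E where "E b = \<Union>{U. openin X U \<and> (\<forall>z\<in>U. P z = b)}" for b
  have op: "openin X (E b)" for b unfolding E_def by (rule openin_Union) auto
  have "z \<in> E (P z)" if "z \<in> C" for z
    using loc[OF that] unfolding E_def by blast
  then have "x \<in> E True" "y \<in> E False" "C \<subseteq> E True \<union> E False"
    using assms(3-5) \<open>\<not> P y\<close> by (metis (full_types), metis (full_types), (metis (full_types) UnCI subsetI))
  moreover have "E True \<inter> E False \<inter> C = {}" unfolding E_def by auto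
  ultimately show False using connectedinD[OF C op[of True] op[of False]] assms(3,4) by blast
qed

text \<open>
  If \<open>f\<close> increases from \<open>x\<close> to \<open>y\<close>, convexity forces at least linear growth beyond \<open>y\<close>.
\<close>

lemma convex_bounded_above_imp_const:
  fixes f :: "real \<Rightarrow> real"
  assumes f: "convex_on UNIV f" and D: "\<And>x. f x \<le> D"
  shows "f x = f y"
proof -
  have le: "f y \<le> f x" for x y
  proof (rule ccontr)
    assume "\<not> f y \<le> f x"
    then have pos: "f y - f x > 0" by simp
    \<comment> \<open>Far enough along the ray from \<open>x\<close> through \<open>y\<close> for the linear lower bound to exceed \<open>D\<close>.\<close>
    define t where "t = (D - f x) / (f y - f x) + 1"
    have Dx: "(D - f x) / (f y - f x) \<ge> 1" using D[of y] pos by (simp add: field_simps)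
    then have t: "t > 1" by (simp add: t_def)
    define z where "z = x + t * (y - x)"
    have "(1 - 1 / t) *\<^sub>R x + (1 / t) *\<^sub>R z = y" using t by (simp add: z_def field_simps)
    moreover have "f ((1 - 1 / t) *\<^sub>R x + (1 / t) *\<^sub>R z) \<le> (1 - 1 / t) * f x + (1 / t) * f z"
      using t by (intro convex_onD[OF f]) auto
    ultimately have "f y \<le> (1 - 1 / t) * f x + (1 / t) * D"
      using D[of z] t by (smt (verit) divide_right_mono mult_left_mono zero_less_divide_1_iff)
    then have "t * (f y - f x) \<le> D - f x" using t by (simp add: field_simps)
    moreover have "t * (f y - f x) = D - f x + (f y - f x)" using pos by (simp add: t_def field_simps)
    ultimately show False using pos by simp
  qed
  from le[of x y] le[of y x] show ?thesis by simp
qed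

lemma convex_concave_imp_affine:
  fixes f :: "real \<Rightarrow> real"
  assumes f: "convex_on UNIV f" and f': "convex_on UNIV (\<lambda>x. - f x)"
  shows "f s = (f 1 - f 0) * s + f 0"
proof -
  have aff: "f ((1 - t) * x + t * y) = (1 - t) * f x + t * f y" if "0 \<le> t" "t \<le> 1" for t x y
    using convex_onD[OF f that, of x y] convex_onD[OF f' that, of x y] by (simp add: algebra_simps)
  consider "0 \<le> s" "s \<le> 1" | "s > 1" | "s < 0" by linarith
  then show ?thesis
  proof cases
    case 1
    then show ?thesis using aff[of s 0 1] by (simp add: algebra_simps)
  next
    case 2
    then have "f 1 = (1 - 1 / s) * f 0 + (1 / s) * f s" using aff[of "1 / s" 0 s] by simp
    then show ?thesis using 2 by (simp add: field_simps)
  next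
    case 3
    define t where "t = - s / (1 - s)"
    have t: "0 \<le> t" "t \<le> 1" using 3 by (auto simp: t_def field_simps)
    have "(1 - t) * s + t * 1 = 0" using 3 by (simp add: t_def field_simps)
    with aff[OF t, of s 1] have "f 0 = (1 - t) * f s + t * f 1" by simp
    moreover have "1 - t = 1 / (1 - s)" using 3 by (simp add: t_def field_simps)
    ultimately have "f 0 = (f s - s * f 1) / (1 - s)" by (simp add: t_def diff_divide_distrib)
    then have "f 0 * (1 - s) = f s - s * f 1" using 3 by (simp add: eq_divide_eq)
    then show ?thesis by (simp add: algebra_simps)
  qed
qed

section \<open>Continuity and oscillation on the slices of the cylinder\<close>

locale cylinder_function =
  fixes F :: "('i, 'a, 'e::euclidean_space) riem_data" and u :: "real \<times> 'a \<Rightarrow> real"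
  assumes manifold: "riemannian_manifold F" and compact: "compact_space (mtop F)"
    and smooth_u: "smooth_function (cyl F) u"
begin

abbreviation "K \<equiv> topspace (mtop F)"
abbreviation "X \<equiv> prod_topology euclideanreal (mtop F)"

lemma chart_function: "j \<in> charts F \<Longrightarrow> cylinder_chart_function F j u"
  using manifold smooth_u
  by unfold_locales (auto simp: riemannian_manifold_def smooth_function_def charts_cyl chart_img_cyl)

lemma chart_at:
  assumes "x \<in> K" shows "\<exists>j\<in>charts F. x \<in> chart_dom F j"
proof -
  have "(\<Union>i\<in>charts F. chart_dom F i) = K"
    using manifold by (simp add: riemannian_manifold_def smooth_manifold_def)
  then show ?thesis using assms by blast
qed

lemma chart_dom_subset: "j \<in> charts F \<Longrightarrow> chart_dom F j \<subseteq> K"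
  using manifold by (auto simp: riemannian_manifold_def smooth_manifold_def)

lemma u_eq_in_chart:
  assumes "j \<in> charts F" "x \<in> chart_dom F j"
  shows "u (s, x) = (u \<circ> chart_inv (cyl F) ((), j)) (s, chart F j x)"
proof -
  interpret cylinder_chart_function F j u using assms(1) by (rule chart_function)
  show ?thesis using assms(2) by (simp add: chart_inv_cyl chart_inv_chart chart_img_def)
qed

lemma openin_chart_preimage:
  assumes j: "j \<in> charts F" and V: "open V"
  shows "openin X {z. snd z \<in> chart_dom F j \<and> (fst z, chart F j (snd z)) \<in> V}" (is "openin X ?W")
proof -
  have op: "openin (mtop F) (chart_dom F j)"
    and "homeomorphic_map (subtopology (mtop F) (chart_dom F j)) (top_of_set (chart_img F j)) (chart F j)"
    using manifold j by (auto simp: riemannian_manifold_def smooth_manifold_def)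
  then have "continuous_map (subtopology (mtop F) (chart_dom F j)) euclidean (chart F j)"
    using homeomorphic_imp_continuous_map continuous_map_in_subtopology by blast
  then have "continuous_map (prod_topology euclideanreal (subtopology (mtop F) (chart_dom F j)))
      (prod_topology euclideanreal euclidean) (\<lambda>(s, x). (s, chart F j x))"
    by (subst continuous_map_prod_top) simp
  then have "openin (prod_topology euclideanreal (subtopology (mtop F) (chart_dom F j)))
      {z \<in> topspace (prod_topology euclideanreal (subtopology (mtop F) (chart_dom F j))).
        (case z of (s, x) \<Rightarrow> (s, chart F j x)) \<in> V}"
    using V unfolding continuous_map_def by (simp add: euclidean_product_topology[symmetric])
  also have "{z \<in> topspace (prod_topology euclideanreal (subtopology (mtop F) (chart_dom F j))).
        (case z of (s, x) \<Rightarrow> (s, chart F j x)) \<in> V} = ?W"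
    using chart_dom_subset[OF j] by auto
  finally have "openin (subtopology X (UNIV \<times> chart_dom F j)) ?W"
    by (simp add: prod_topology_subtopology(2))
  moreover have "openin X (UNIV \<times> chart_dom F j)"
    using op by (simp add: openin_prod_Times_iff)
  ultimately show ?thesis by (rule openin_trans_full)
qed

lemma continuous_u: "continuous_map X euclideanreal u"
  unfolding continuous_map_def
proof (intro conjI allI impI)
  fix U :: "real set" assume "openin euclideanreal U"
  then have U: "open U" by simp
  show "openin X {z \<in> topspace X. u z \<in> U}"
  proof (subst openin_subopen, intro ballI)
    fix z assume z: "z \<in> {z \<in> topspace X. u z \<in> U}"
    then have "snd z \<in> K" by auto
    then obtain j where j: "j \<in> charts F" "snd z \<in> chart_dom F j" using chart_at by blast
    interpret cylinder_chart_function F j u using j(1) by (rule chart_function)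
    have "open (S \<inter> h -` U)"
      using continuous_open_preimage[OF Cinf_onD(1)[OF smooth_u] open_S U] .
    from openin_chart_preimage[OF j(1) this]
    have "openin X {z. snd z \<in> chart_dom F j \<and> (fst z, chart F j (snd z)) \<in> S \<inter> h -` U}" (is "openin X ?W") .
    moreover have W: "y \<in> ?W \<longleftrightarrow> snd y \<in> chart_dom F j \<and> u y \<in> U" for y
      using u_eq_in_chart[OF j(1), of "snd y" "fst y"] by (auto simp: chart_img_def)
    have "z \<in> ?W" using z j W by blast
    moreover have "?W \<subseteq> {z \<in> topspace X. u z \<in> U}"
    proof
      fix y assume "y \<in> ?W"
      then have "snd y \<in> chart_dom F j" "u y \<in> U" using W by blast+
      then show "y \<in> {z \<in> topspace X. u z \<in> U}"
        using chart_dom_subset[OF j(1)] by (auto simp: mem_Times_iff)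
    qed
    ultimately show "\<exists>T. openin X T \<and> z \<in> T \<and> T \<subseteq> {z \<in> topspace X. u z \<in> U}" by blast
  qed
qed auto

lemma continuous_on_slice:
  assumes "x \<in> K" shows "continuous_on UNIV (\<lambda>s. u (s, x))"
proof -
  have "continuous_map euclideanreal X (\<lambda>s. (s, x))"
    using assms by (simp add: continuous_map_pairedI)
  from continuous_map_compose[OF this continuous_u] show ?thesis by (simp add: o_def)
qed

lemma continuous_tilted: "continuous_map X euclideanreal (\<lambda>z. c * u z + k * fst z)"
  by (intro continuous_map_add continuous_map_real_mult_left continuous_u continuous_map_fst)

lemma tilted_attains_max:
  assumes "compact I" "I \<noteq> {}" "K \<noteq> {}"
  shows "\<exists>s0\<in>I. \<exists>x0\<in>K. \<forall>s\<in>I. \<forall>x\<in>K. c * u (s, x) + k * s \<le> c * u (s0, x0) + k * s0"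
proof -
  have "compactin X (I \<times> K)"
    using assms(1) compact by (simp add: compactin_Times compact_space_def)
  from image_compactin[OF this continuous_tilted]
  have "compact ((\<lambda>z. c * u z + k * fst z) ` (I \<times> K))" by simp
  from compact_attains_sup[OF this] assms(2,3) show ?thesis by force
qed

text \<open>
  The metric of \<open>F\<close> is independent of \<open>s\<close>, so on a compact coordinate ball it is at most \<open>L\<close> times
  the Euclidean one for all slices at once. A bound \<open>C\<close> on the gradient thus makes
  \<open>u (s, \<cdot>)\<close> Lipschitz on the ball with constant \<open>C \<surd>L\<close>, independent of \<open>s\<close>.
\<close>

lemma bounded_gradient_locally_bounded_oscillation:
  assumes bg: "bounded_gradient (cyl F) u" and x0: "x0 \<in> K"
  shows "\<exists>U D. openin (mtop F) U \<and> x0 \<in> U \<and> (\<forall>x\<in>U. \<forall>s. \<bar>u (s, x) - u (s, x0)\<bar> \<le> D)"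
proof -
  obtain j where j: "j \<in> charts F" "x0 \<in> chart_dom F j" using chart_at[OF x0] by blast
  interpret cylinder_chart_function F j u using j(1) by (rule chart_function)
  define y0 where "y0 = chart F j x0"
  have "y0 \<in> chart_img F j" using j unfolding y0_def chart_img_def by (intro imageI)
  then obtain r where r: "r > 0" "cball y0 r \<subseteq> chart_img F j"
    using open_chart_img open_contains_cball by blast
  obtain C where C: "\<And>y. y \<in> S \<Longrightarrow> sqrt (N y) \<le> C"
    using bg j(1) unfolding bounded_gradient_def charts_cyl
    by (force simp: chart_img_cyl grad_length_cyl)
  define \<kappa> where "\<kappa> q = (\<Sum>b\<in>Basis. \<Sum>b'\<in>Basis. \<bar>metric F j q b b'\<bar>)" for q
  have "continuous_on (cball y0 r) \<kappa>"
    unfolding \<kappa>_def using continuous_on_subset[OF Cinf_onD(1)[OF smooth_metric] r(2)]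
    by (intro continuous_intros)
  then have "\<exists>p\<in>cball y0 r. \<forall>q\<in>cball y0 r. \<kappa> q \<le> \<kappa> p"
    using r(1) by (intro continuous_attains_sup) auto
  then obtain L where L: "\<And>q. q \<in> cball y0 r \<Longrightarrow> \<kappa> q \<le> L" by blast
  have metric_le: "metric F j q v v \<le> L * (norm v)\<^sup>2" if q: "q \<in> cball y0 r" for q v
  proof -
    have b: "bilinear (metric F j q)" using inner_form_F q r(2) by (auto simp: inner_form_def)
    have "metric F j q v v = (\<Sum>b\<in>Basis. \<Sum>b'\<in>Basis. (v \<bullet> b) * ((v \<bullet> b') * metric F j q b b'))"
      unfolding bilinear_expand_left[OF b, of v v]
      by (subst bilinear_expand_right[OF b]) (simp add: sum_distrib_left)
    also have "\<dots> \<le> (\<Sum>b\<in>Basis. \<Sum>b'\<in>Basis. (norm v)\<^sup>2 * \<bar>metric F j q b b'\<bar>)"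
    proof (intro sum_mono)
      fix b b' :: 'e assume "b \<in> Basis" "b' \<in> Basis"
      then have "\<bar>v \<bullet> b\<bar> * (\<bar>v \<bullet> b'\<bar> * \<bar>metric F j q b b'\<bar>) \<le> norm v * (norm v * \<bar>metric F j q b b'\<bar>)"
        by (intro mult_mono mult_nonneg_nonneg) (auto simp: Basis_le_norm)
      then show "(v \<bullet> b) * ((v \<bullet> b') * metric F j q b b') \<le> (norm v)\<^sup>2 * \<bar>metric F j q b b'\<bar>"
        using abs_ge_self[of "(v \<bullet> b) * ((v \<bullet> b') * metric F j q b b')"]
        by (simp add: abs_mult power2_eq_square mult.assoc)
    qed
    also have "\<dots> = \<kappa> q * (norm v)\<^sup>2" by (simp add: \<kappa>_def sum_distrib_left mult.commute)
    also have "\<dots> \<le> L * (norm v)\<^sup>2" using L[OF q] by (intro mult_right_mono) auto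
    finally show ?thesis .
  qed
  have L0: "L \<ge> 0"
    using L[of y0] r(1) unfolding \<kappa>_def by (smt (verit) centre_in_cball sum_nonneg abs_ge_zero)
  have C0: "C \<ge> 0"
    using C[of "(0, y0)"] N_nonneg[of "(0, y0)"] \<open>y0 \<in> _\<close>
    by (smt (verit) SigmaI UNIV_I real_sqrt_ge_zero)
  have bound: "\<bar>h (s, q) - h (s, y0)\<bar> \<le> C * sqrt L * norm (q - y0)" if q: "q \<in> cball y0 r" for s q
  proof -
    have "norm (h (s, q) - h (s, y0)) \<le> C * sqrt L * norm (q - y0)"
    proof (rule differentiable_bound[where f' = "\<lambda>q v. f' (s, q) (0, v)"])
      fix q assume q: "q \<in> cball y0 r"
      then have S: "(s, q) \<in> S" using r(2) by auto
      have "((\<lambda>q. (s, q)) has_derivative (\<lambda>v. (0, v))) (at q within cball y0 r)"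
        by (auto intro!: derivative_eq_intros)
      then show "((\<lambda>q. h (s, q)) has_derivative (\<lambda>v. f' (s, q) (0, v))) (at q within cball y0 r)"
        using has_derivative_f[OF S] by (rule has_derivative_compose)
      show "onorm (\<lambda>v. f' (s, q) (0, v)) \<le> C * sqrt L"
      proof (rule onorm_bound)
        fix v
        have "(f' (s, q) (0, v))\<^sup>2 \<le> N (s, q) * g (s, q) (0, v) (0, v)"
          using inner_form_Cauchy_Schwarz[OF inner[OF S]] by (simp add: g_G[OF S, symmetric])
        also have "\<dots> \<le> C\<^sup>2 * (L * (norm v)\<^sup>2)"
        proof (intro mult_mono)
          show "N (s, q) \<le> C\<^sup>2" using C[OF S] N_nonneg[OF S] by (simp add: sqrt_le_D)
          show "g (s, q) (0, v) (0, v) \<le> L * (norm v)\<^sup>2" using metric_le[OF q] by (simp add: metric_cyl)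
        qed (use inner_form_nonneg[OF inner[OF S]] in auto)
        also have "\<dots> = (C * sqrt L * norm v)\<^sup>2" using L0 by (simp add: power_mult_distrib)
        finally show "norm (f' (s, q) (0, v)) \<le> C * sqrt L * norm v"
          using C0 L0 by (metis abs_le_square_iff abs_of_nonneg mult_nonneg_nonneg norm_ge_zero real_norm_def real_sqrt_ge_zero)
      qed (use C0 L0 in simp)
    qed (use q r(1) in auto)
    then show ?thesis by simp
  qed
  define U where "U = {x \<in> chart_dom F j. chart F j x \<in> ball y0 r}"
  have "openin X {z. snd z \<in> chart_dom F j \<and> (fst z, chart F j (snd z)) \<in> UNIV \<times> ball y0 r}"
    by (intro openin_chart_preimage j open_Times) auto
  also have "{z. snd z \<in> chart_dom F j \<and> (fst z, chart F j (snd z)) \<in> UNIV \<times> ball y0 r} = UNIV \<times> U"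
    by (auto simp: U_def)
  finally have "openin (mtop F) U" by (auto simp: openin_prod_Times_iff)
  moreover have "x0 \<in> U" using j r(1) by (simp add: U_def y0_def)
  moreover have "\<bar>u (s, x) - u (s, x0)\<bar> \<le> C * sqrt L * r" if "x \<in> U" for x s
  proof -
    have x: "x \<in> chart_dom F j" "chart F j x \<in> cball y0 r" using that by (auto simp: U_def)
    have "\<bar>u (s, x) - u (s, x0)\<bar> \<le> C * sqrt L * norm (chart F j x - y0)"
      using bound[OF x(2), of s] unfolding u_eq_in_chart[OF j(1) x(1)] u_eq_in_chart[OF j] y0_def .
    also have "\<dots> \<le> C * sqrt L * r"
      using x(2) C0 L0 by (intro mult_left_mono) (auto simp: dist_norm norm_minus_commute)
    finally show ?thesis .
  qed
  ultimately show ?thesis by blast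
qed

text \<open>
  Being at bounded distance from \<open>u (s, x0)\<close> uniformly in \<open>s\<close> is a locally constant property of the
  point, so it holds everywhere on the connected space \<open>F\<close>; compactness makes the bound uniform.
\<close>

lemma bounded_gradient_bounded_oscillation:
  assumes bg: "bounded_gradient (cyl F) u"
  shows "\<exists>D. \<forall>s. \<forall>x\<in>K. \<forall>y\<in>K. u (s, x) - u (s, y) \<le> D"
proof (cases "K = {}")
  case False
  then obtain x0 where x0: "x0 \<in> K" by blast
  have "connectedin (mtop F) K"
    using manifold by (simp add: riemannian_manifold_def connectedin_topspace)
  define P where "P x \<longleftrightarrow> (\<exists>D. \<forall>s. \<bar>u (s, x) - u (s, x0)\<bar> \<le> D)" for x
  have P_trans: "P y" if Px: "P x" and xy: "\<And>s. \<bar>u (s, y) - u (s, x)\<bar> \<le> D" for x y D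
  proof -
    obtain E where E: "\<And>s. \<bar>u (s, x) - u (s, x0)\<bar> \<le> E" using Px unfolding P_def by blast
    have "\<bar>u (s, y) - u (s, x0)\<bar> \<le> D + E" for s using xy[of s] E[of s] by linarith
    then show ?thesis unfolding P_def by blast
  qed
  have P: "P x" if "x \<in> K" for x
  proof (rule connectedin_locally_constant[OF \<open>connectedin (mtop F) K\<close> _ x0 that])
    fix z assume "z \<in> K"
    from bounded_gradient_locally_bounded_oscillation[OF bg this]
    obtain U D where U: "openin (mtop F) U" "z \<in> U" "\<And>x s. x \<in> U \<Longrightarrow> \<bar>u (s, x) - u (s, z)\<bar> \<le> D" by blast
    have "P y \<longleftrightarrow> P z" if "y \<in> U" for y
    proof
      show "P y" if "P z" using that U(3)[OF \<open>y \<in> U\<close>] by (rule P_trans)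
      show "P z" if "P y"
        using that by (rule P_trans) (use U(3)[OF \<open>y \<in> U\<close>] in \<open>simp add: abs_minus_commute\<close>)
    qed
    then show "\<exists>U. openin (mtop F) U \<and> z \<in> U \<and> (\<forall>y\<in>U. P y \<longleftrightarrow> P z)"
      using U(1,2) by blast
  next
    show "P x0" unfolding P_def by (rule exI[of _ 0]) simp
  qed
  define \<U> where "\<U> = {U. openin (mtop F) U \<and> (\<exists>D. \<forall>x\<in>U. \<forall>s. \<bar>u (s, x) - u (s, x0)\<bar> \<le> D)}"
  have "K \<subseteq> \<Union>\<U>"
  proof
    fix x assume x: "x \<in> K"
    from bounded_gradient_locally_bounded_oscillation[OF bg this]
    obtain U D where U: "openin (mtop F) U" "x \<in> U" "\<And>y s. y \<in> U \<Longrightarrow> \<bar>u (s, y) - u (s, x)\<bar> \<le> D" by blast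
    obtain E where E: "\<And>s. \<bar>u (s, x) - u (s, x0)\<bar> \<le> E" using P[OF x] unfolding P_def by blast
    have "\<bar>u (s, y) - u (s, x0)\<bar> \<le> D + E" if "y \<in> U" for y s
      using U(3)[OF that, of s] E[of s] by linarith
    then show "x \<in> \<Union>\<U>" using U(1,2) unfolding \<U>_def by blast
  qed
  moreover have "\<forall>U\<in>\<U>. openin (mtop F) U" by (simp add: \<U>_def)
  ultimately obtain \<F> where \<F>: "finite \<F>" "\<F> \<subseteq> \<U>" "K \<subseteq> \<Union>\<F>"
    using compact unfolding compact_space_alt by meson
  then obtain D where D: "\<And>U x s. U \<in> \<F> \<Longrightarrow> x \<in> U \<Longrightarrow> \<bar>u (s, x) - u (s, x0)\<bar> \<le> D U"
  proof -
    have "\<forall>U\<in>\<F>. \<exists>D. \<forall>x\<in>U. \<forall>s. \<bar>u (s, x) - u (s, x0)\<bar> \<le> D"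
      using \<F>(2) unfolding \<U>_def by blast
    from bchoice[OF this] that show thesis by blast
  qed
  define E where "E = (\<Sum>U\<in>\<F>. \<bar>D U\<bar>)"
  have E: "\<bar>u (s, x) - u (s, x0)\<bar> \<le> E" if x: "x \<in> K" for s x
  proof -
    obtain U where U: "U \<in> \<F>" "x \<in> U" using \<F>(3) x by blast
    have "\<bar>D U\<bar> \<le> E" unfolding E_def using U(1) \<F>(1) by (intro member_le_sum) auto
    then show ?thesis using D[OF U, of s] by linarith
  qed
  have "u (s, x) - u (s, y) \<le> 2 * E" if "x \<in> K" "y \<in> K" for s x y
    using E[OF that(1), of s] E[OF that(2), of s] by linarith
  then show ?thesis by blast
qed simp

end

section \<open>Slice maxima and rigidity\<close>

locale cylinder_minimal_graph = cylinder_function +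
  assumes minimal: "minimal_graph_equation (cyl F) u"
begin

text \<open>
  The set where the maximum \<open>m\<close> is attained is open by the principle in charts and closed by
  continuity, and \<open>I \<times> F\<close> is connected.
\<close>

lemma strong_maximum_principle:
  assumes I: "open I" "connected I" and s': "s' \<in> I" "x' \<in> K"
    and max: "\<And>s x. s \<in> I \<Longrightarrow> x \<in> K \<Longrightarrow> c * u (s, x) + k * s \<le> m" "c * u (s', x') + k * s' = m"
    and s: "s \<in> I" "x \<in> K"
  shows "c * u (s, x) + k * s = m"
proof -
  define w where "w z = c * u z + k * fst z" for z
  have "connectedin X (I \<times> K)"
    using I(2) manifold by (simp add: connectedin_Times riemannian_manifold_def connectedin_topspace)
  then have "w (s, x) = m"
  proof (rule connectedin_locally_constant[where x = "(s', x')"])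
    fix z assume z: "z \<in> I \<times> K"
    show "\<exists>U. openin X U \<and> z \<in> U \<and> (\<forall>y\<in>U. (w y = m) \<longleftrightarrow> (w z = m))"
    proof (cases "w z = m")
      case False
      have "openin X {y \<in> topspace X. w y \<in> - {m}}"
        using continuous_tilted[of c k] unfolding w_def
        by (rule openin_continuous_map_preimage) (simp add: open_Compl)
      then show ?thesis using False z by (intro exI[of _ "{y \<in> topspace X. w y \<in> - {m}}"]) auto
    next
      case True
      obtain j where j: "j \<in> charts F" "snd z \<in> chart_dom F j" using z chart_at[of "snd z"] by auto
      interpret cylinder_chart_function F j u using j(1) by (rule chart_function)
      define T where "T = I \<times> chart_img F j"
      define p where "p = (fst z, chart F j (snd z))"
      have hw: "w (t, chart_inv F j q) = c * h (t, q) + k * fst (t, q)" if "q \<in> chart_img F j" for t q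
        using that by (simp add: w_def chart_inv_cyl)
      have "\<exists>r>0. ball p r \<subseteq> T \<and> (\<forall>y\<in>ball p r. c * h y + k * fst y = m)"
      proof (rule strong_maximum_principle_chart)
        show "divergence g (\<lambda>p. (1 / sqrt (1 + (grad_length (cyl F) u ((), j) p)\<^sup>2)) *\<^sub>R grad (cyl F) u ((), j) p) y = 0"
          if "y \<in> S" for y
          using minimal that j(1) by (auto simp: minimal_graph_equation_def charts_cyl chart_img_cyl)
        show "open T" unfolding T_def by (intro open_Times I(1) open_chart_img)
        show "T \<subseteq> S" "p \<in> T" using z j by (auto simp: T_def p_def chart_img_def)
        show "c * h y + k * fst y \<le> m" if yT: "y \<in> T" for y
        proof -
          obtain t q where y: "y = (t, q)" "t \<in> I" "q \<in> chart_img F j" using yT unfolding T_def by (rule SigmaE)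
          have "chart_inv F j q \<in> K" using chart_inv_in_dom[OF y(3)] chart_dom_subset[OF j(1)] by auto
          from max(1)[OF y(2) this] show ?thesis
            unfolding y(1) hw[OF y(3), symmetric] w_def by simp
        qed
        show "c * h p + k * fst p = m"
          using True u_eq_in_chart[OF j, of "fst z"] by (simp add: p_def w_def)
      qed
      then obtain r where r: "r > 0" "\<And>y. y \<in> ball p r \<Longrightarrow> c * h y + k * fst y = m" by blast
      define W where "W = {z. snd z \<in> chart_dom F j \<and> (fst z, chart F j (snd z)) \<in> ball p r}"
      have "openin X W" unfolding W_def by (rule openin_chart_preimage[OF j(1) open_ball])
      moreover have "z \<in> W" using j r(1) by (simp add: W_def p_def)
      moreover have "w y = m" if "y \<in> W" for y
      proof -
        have "c * h (fst y, chart F j (snd y)) + k * fst (fst y, chart F j (snd y)) = m"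
          using that by (intro r(2)) (simp add: W_def)
        then show ?thesis
          using that u_eq_in_chart[OF j(1), of "snd y" "fst y"] by (simp add: W_def w_def)
      qed
      ultimately show ?thesis using True by blast
    qed
  qed (use s s' max in \<open>auto simp: w_def\<close>)
  then show ?thesis by (simp add: w_def)
qed

definition slice_max :: "real \<Rightarrow> real \<Rightarrow> real" where
  "slice_max c s = (SUP x\<in>K. c * u (s, x))"

lemma slice_max_attained:
  assumes "K \<noteq> {}"
  shows "\<exists>x\<in>K. slice_max c s = c * u (s, x) \<and> (\<forall>y\<in>K. c * u (s, y) \<le> c * u (s, x))"
proof -
  obtain x where x: "x \<in> K" "\<And>y. y \<in> K \<Longrightarrow> c * u (s, y) \<le> c * u (s, x)"
    using tilted_attains_max[of "{s}" c 0] assms by auto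
  then have "slice_max c s = c * u (s, x)"
    unfolding slice_max_def by (intro cSup_eq_maximum) auto
  with x show ?thesis by blast
qed

lemma slice_max_upper: "x \<in> K \<Longrightarrow> c * u (s, x) \<le> slice_max c s"
  using slice_max_attained[of c s] by fastforce

text \<open>
  Tilt \<open>c u\<close> by a linear function of \<open>s\<close> such that its maxima over the slices at \<open>s1\<close> and \<open>s2\<close> take
  a common value \<open>d\<close>. A larger maximum over the slab in between would be attained in the
  interior and hence everywhere in the slab, and by continuity also on the slice at \<open>s1\<close>.
\<close>

lemma convex_slice_max:
  assumes K: "K \<noteq> {}" shows "convex_on UNIV (slice_max c)"
proof (rule convex_on_linorderI)
  fix t s1 s2 :: real assume t: "0 < t" "t < 1" and s12: "s1 < s2"
  define k where "k = (slice_max c s1 - slice_max c s2) / (s2 - s1)"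
  define d where "d = slice_max c s1 + k * s1"
  have d: "d = slice_max c s2 + k * s2"
  proof -
    have "k * (s2 - s1) = slice_max c s1 - slice_max c s2" using s12 by (simp add: k_def)
    then show ?thesis by (simp add: d_def algebra_simps)
  qed
  have ends: "c * u (s1, x) + k * s1 \<le> d" "c * u (s2, x) + k * s2 \<le> d" if "x \<in> K" for x
    using slice_max_upper[OF that, of c s1] slice_max_upper[OF that, of c s2] d d_def by linarith+
  obtain s0 x0 where s0: "s0 \<in> {s1..s2}" "x0 \<in> K"
    and max: "\<And>s x. s \<in> {s1..s2} \<Longrightarrow> x \<in> K \<Longrightarrow> c * u (s, x) + k * s \<le> c * u (s0, x0) + k * s0"
  proof -
    have "{s1..s2} \<noteq> {}" using s12 by simp
    from tilted_attains_max[OF compact_Icc this K, of c k] that show thesis by blast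
  qed
  define m where "m = c * u (s0, x0) + k * s0"
  have "m \<le> d"
  proof (rule ccontr)
    assume md: "\<not> m \<le> d"
    then have "s0 \<noteq> s1" "s0 \<noteq> s2" using ends[OF s0(2)] by (auto simp: m_def)
    then have s0': "s0 \<in> {s1<..<s2}" using s0(1) by auto
    have "c * u (s, x0) + k * s = m" if "s \<in> {s1<..<s2}" for s
      by (rule strong_maximum_principle[OF open_greaterThanLessThan connected_Ioo s0' s0(2) _ _ that s0(2)])
         (use max in \<open>auto simp: m_def\<close>)
    moreover have "continuous_on (closure {s1<..<s2}) (\<lambda>s. c * u (s, x0) + k * s)"
      by (intro continuous_intros continuous_on_subset[OF continuous_on_slice[OF s0(2)]]) simp
    moreover have "s1 \<in> closure {s1<..<s2}" using s12 by simp
    ultimately have "c * u (s1, x0) + k * s1 = m" using continuous_constant_on_closure by blast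
    then show False using ends(1)[OF s0(2)] md by simp
  qed
  define s where "s = (1 - t) *\<^sub>R s1 + t *\<^sub>R s2"
  have "s = s1 + t * (s2 - s1)" "s = s2 - (1 - t) * (s2 - s1)" by (simp_all add: s_def algebra_simps)
  then have s: "s \<in> {s1..s2}" using t s12 by (smt (verit) atLeastAtMost_iff mult_nonneg_nonneg)
  obtain x where "x \<in> K" "slice_max c s = c * u (s, x)" using slice_max_attained[OF K, of c s] by blast
  then have "slice_max c s + k * s \<le> d" using max[OF s, of x] \<open>m \<le> d\<close> unfolding m_def by linarith
  also have "d = (1 - t) * (slice_max c s1 + k * s1) + t * (slice_max c s2 + k * s2)"
    unfolding d[symmetric] d_def[symmetric] by (simp add: left_diff_distrib)
  finally show "slice_max c ((1 - t) *\<^sub>R s1 + t *\<^sub>R s2) \<le> (1 - t) * slice_max c s1 + t * slice_max c s2"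
    by (simp add: s_def algebra_simps)
qed simp

text \<open>
  \<open>M\<close> and \<open>L\<close> are the slice maxima of \<open>u\<close> and \<open>- u\<close>. Both are convex and their sum is the oscillation,
  which is bounded, hence constant. So \<open>M\<close> is convex and concave, that is, affine, and
  \<open>u - M\<close> attains its maximum \<open>0\<close> in every slice.
\<close>

lemma bounded_gradient_imp_affine:
  assumes bg: "bounded_gradient (cyl F) u" and K: "K \<noteq> {}"
  shows "\<exists>a b. \<forall>s. \<forall>x\<in>K. u (s, x) = a * s + b"
proof -
  define M where "M = slice_max 1"
  define L where "L = slice_max (- 1)"
  obtain D where D: "\<And>s x y. x \<in> K \<Longrightarrow> y \<in> K \<Longrightarrow> u (s, x) - u (s, y) \<le> D"
    using bounded_gradient_bounded_oscillation[OF bg] by blast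
  have convex: "convex_on UNIV M" "convex_on UNIV L"
    unfolding M_def L_def by (rule convex_slice_max[OF K])+
  have "M s + L s \<le> D" for s
  proof -
    obtain x y where "x \<in> K" "y \<in> K" "M s = 1 * u (s, x)" "L s = - 1 * u (s, y)"
      unfolding M_def L_def using slice_max_attained[OF K] by meson
    then show ?thesis using D[of x y s] by simp
  qed
  then have "M s + L s = M 0 + L 0" for s
    using convex_bounded_above_imp_const[OF convex_on_add[OF convex]] by blast
  then have "(\<lambda>s. - M s) = (\<lambda>s. L s + - (M 0 + L 0))" by (intro ext) (metis add.commute add_diff_cancel_left' diff_conv_add_uminus minus_diff_eq)
  moreover have "convex_on UNIV (\<lambda>s. L s + - (M 0 + L 0))"
    by (intro convex_on_add convex) (auto simp: convex_on_def simp flip: distrib_right)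
  ultimately have M: "M s = (M 1 - M 0) * s + M 0" for s
    using convex_concave_imp_affine[OF convex(1)] by metis
  obtain x0 where x0: "x0 \<in> K" "M 0 = u (0, x0)"
    using slice_max_attained[OF K, of 1 0] unfolding M_def by auto
  have "1 * u (s, x) + - (M 1 - M 0) * s = M 0" if "x \<in> K" for s x
  proof (rule strong_maximum_principle[where s' = 0, OF open_UNIV connected_UNIV UNIV_I x0(1) _ _ UNIV_I that])
    fix s x assume "x \<in> K"
    then have "1 * u (s, x) \<le> M s" unfolding M_def by (rule slice_max_upper)
    then show "1 * u (s, x) + - (M 1 - M 0) * s \<le> M 0" using M[of s] by (simp add: algebra_simps)
  qed (simp add: x0)
  then have "u (s, x) = (M 1 - M 0) * s + M 0" if "x \<in> K" for s x
    using that by (simp add: algebra_simps)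
  then show ?thesis by blast
qed

end

section \<open>Affine functions are solutions\<close>

lemma affine_in_chart:
  assumes F: "riemannian_manifold F" and aff: "\<And>s x. x \<in> topspace (mtop F) \<Longrightarrow> u (s, x) = a * s + b"
    and j: "j \<in> charts F" and p: "p \<in> UNIV \<times> chart_img F j"
  shows "(u \<circ> chart_inv (cyl F) ((), j)) p = a * fst p + b"
proof -
  interpret cylinder_chart F j using F j by unfold_locales (auto simp: riemannian_manifold_def)
  have "chart_dom F j \<subseteq> topspace (mtop F)"
    using F j by (auto simp: riemannian_manifold_def smooth_manifold_def)
  then show ?thesis using p chart_inv_in_dom aff by (force simp: chart_inv_cyl)
qed

lemma affine_imp_solution:
  assumes F: "riemannian_manifold F" and aff: "\<And>s x. x \<in> topspace (mtop F) \<Longrightarrow> u (s, x) = a * s + b"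
  shows "smooth_function (cyl F) u" "minimal_graph_equation (cyl F) u" "bounded_gradient (cyl F) u"
proof -
  have chart: "cylinder_chart_function F j u" if j: "j \<in> charts F" for j
  proof -
    interpret cylinder_chart F j using F j by unfold_locales (auto simp: riemannian_manifold_def)
    have "Cinf_on S (\<lambda>p. a * fst p + b)"
      by (rule Cinf_on_affine) (intro bounded_linear_intros)
    moreover have "Ck_on k S (u \<circ> chart_inv (cyl F) ((), j)) \<longleftrightarrow> Ck_on k S (\<lambda>p. a * fst p + b)" for k
      by (rule Ck_on_cong[OF open_S]) (rule affine_in_chart[OF F aff j])
    ultimately show ?thesis by unfold_locales (simp add: Cinf_on_def)
  qed
  show "smooth_function (cyl F) u"
    using chart by (auto simp: smooth_function_def charts_cyl chart_img_cyl cylinder_chart_function_def cylinder_chart_function_axioms_def)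
  show "minimal_graph_equation (cyl F) u"
    unfolding minimal_graph_equation_def charts_cyl
  proof safe
    fix j and s :: real and y assume j: "j \<in> charts F" and y: "(s, y) \<in> chart_img (cyl F) ((), j)"
    interpret cylinder_chart_function F j u using j by (rule chart)
    show "divergence g (\<lambda>p. (1 / sqrt (1 + (grad_length (cyl F) u ((), j) p)\<^sup>2)) *\<^sub>R grad (cyl F) u ((), j) p) (s, y) = 0"
      by (rule affine_solution(2)[OF affine_in_chart[OF F aff j]]) (use y in \<open>auto simp: chart_img_cyl\<close>)
  qed
  show "bounded_gradient (cyl F) u"
    unfolding bounded_gradient_def charts_cyl
  proof (intro exI[of _ "\<bar>a\<bar>"], safe)
    fix j and s :: real and y assume j: "j \<in> charts F" and y: "(s, y) \<in> chart_img (cyl F) ((), j)"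
    interpret cylinder_chart_function F j u using j by (rule chart)
    have "grad_length (cyl F) u ((), j) (s, y) = \<bar>a\<bar>"
      by (rule affine_solution(1)[OF affine_in_chart[OF F aff j]]) (use y in \<open>auto simp: chart_img_cyl\<close>)
    then show "grad_length (cyl F) u ((), j) (s, y) \<le> \<bar>a\<bar>" by simp
  qed
qed

theorem theorem20:
  fixes F :: "('i, 'a, 'e::euclidean_space) riem_data"
    and u :: "real \<times> 'a \<Rightarrow> real"
  assumes "riemannian_manifold F"
    and "compact_space (mtop F)"
    and "ricci_nonpositive F"
    and "euler_characteristic (mtop F) \<noteq> 0"
  shows "smooth_function (riem_prod riem_line F) u \<and>
         minimal_graph_equation (riem_prod riem_line F) u \<and>
         bounded_gradient (riem_prod riem_line F) u
     \<longleftrightarrow> (\<exists>a b. \<forall>s. \<forall>x\<in>topspace (mtop F). u (s, x) = a * s + b)"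
proof
  assume *: "smooth_function (riem_prod riem_line F) u \<and>
         minimal_graph_equation (riem_prod riem_line F) u \<and>
         bounded_gradient (riem_prod riem_line F) u"
  then interpret cylinder_minimal_graph F u using assms by unfold_locales auto
  show "\<exists>a b. \<forall>s. \<forall>x\<in>topspace (mtop F). u (s, x) = a * s + b"
  proof (cases "K = {}")
    case False
    show ?thesis using * by (intro bounded_gradient_imp_affine False) simp
  qed simp
next
  assume "\<exists>a b. \<forall>s. \<forall>x\<in>topspace (mtop F). u (s, x) = a * s + b"
  then show "smooth_function (riem_prod riem_line F) u \<and>
         minimal_graph_equation (riem_prod riem_line F) u \<and>
         bounded_gradient (riem_prod riem_line F) u"
    using affine_imp_solution[OF assms(1)] by blast
qed

end
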